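(* Let $\mathbf a=(a_1,\dots,a_h)$ ($h\ge2$) be a composition of $n$, let $\mathcal T$ be a planar rooted binary tree with $h$ leaves, and let $0\le m\le n$. Then the set $$\{\Phi(\mathcal T(\mathbf a),m,\mathcal T_{\mathrm r}(\mathbf k)):\ \mathcal T_{\mathrm r}(\mathbf k)\text{ is a representation labeling of }\mathcal T\text{ for }(\mathbf a,m)\}$$ is an orthogonal basis for the space of $S_{\mathbf a}$-invariant functions in $M^{n-m,m}$.
   Context: $M^{n-m,m}$ is the space of complex functions on the $m$-subsets of $\{1,\dots,n\}$ with inner product $\langle f_1,f_2\rangle=\sum f_1\overline{f_2}$ and the natural $S_n$-action. For $X\subseteq\{1,\dots,n\}$, $\sigma_s(X)$ is the constant function $1$ on the set of $s$-subsets of $X$. If $F$ is a function on $p$-subsets of $X$ and $G$ on $q$-subsets of $Y$, $X\cap Y=\emptyset$, then $F\otimes G$ is the function on $(p+q)$-subsets $Z$ of $X\cup Y$ equal to $F(Z\cap X)G(Z\cap Y)$ if $|Z\cap X|=p$ and $0$ otherwise. Composition: $a_1,\dots,a_h$ are positive integers with sum $n$; $A_r=\{a_1+\dots+a_{r-1}+1,\dots,a_1+\dots+a_r\}$ and $S_{\mathbf a}=S_{a_1}\times\cdots\times S_{a_h}$, with $S_{a_r}$ permuting $A_r$. Trees: every internal vertex of $\mathcal T$ has exactly a left son and a right son; the leaves from left to right carry $a_1,\dots,a_h$. For a vertex $\tau$ let $N_\tau$ be the sum of the parts at the leaves of the subtree rooted at $\tau$. A representation labeling $\mathcal T_{\mathrm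 r}(\mathbf k)$ for $(\mathbf a,m)$ assigns to each vertex $\tau$ an integer $k_\tau\ge0$, with $k_\tau=0$ if $\tau$ is a leaf, such that for every internal $\tau$ with left son $\beta$ and right son $\gamma$: $0\le k_\beta\le N_\beta/2$, $0\le k_\gamma\le N_\gamma/2$, $k_\tau-N_\beta\le k_\gamma-k_\beta\le N_\gamma-k_\tau$, $k_\beta+k_\gamma\le k_\tau$; and the label $k$ of the root satisfies $k\le\min\{m,n-m\}$. $\mathcal T',\mathcal T''$ denote the subtrees rooted at the left and right sons of the root, with the inherited labelings; $t$ is the number of leaves of $\mathcal T'$, $\underline a_t=a_1+\dots+a_t$, and $i,j$ are the labels of the left and right sons of the root. The function $\Phi$ is defined recursively: if the tree is a single leaf with block $A_r$, $\Phi=\sigma_m(A_r)$; otherwise $$\Phi(\mathcal T(\mathbf a),m,\mathcal T_{\mathrm r}(\mathbf k))=\sum_{w=\max\{j,i-\underline a_t+m\}}^{\min\{n-\underline a_t-j,m-i\}}E_{k-i-j}(n-\underline a_t-2j,\underline a_t-2i,m-i-j,w-j)\,\Phi(\mathcal T'(\mathbf a),m-w,\mathcal T'_{\mathrm r}(\mathbf k))\otimes\Phi(\mathcal T''(\mathbf a),w,\mathcal T''_{\mathrm r}(\mathbf k)).$$ Here, for integers with $0\le c\le a+b$, $0\le m\le\min\{a,b,c,a+b-c\}$, $\max\{c-b,0\}\le x\le\min\{a,c\}$, $E_m(a,b,c,x)=\sum_{r=\max\{0,x-c+m\}}^{\min\{m,x\}}(-1)^r\binom{m}{r}(b-m+1)_r(-x)_r(a-m+1)_{m-r}(x-c)_{m-r}$,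 with $(x)_s=x(x+1)\cdots(x+s-1)$. *)

theory Defs
  imports
    Complex_Main
    "HOL-Library.Function_Algebras"
    "HOL-Library.Ramsey"
    "HOL-Combinatorics.Permutations"
begin

(* A function on the m-subsets of X is represented by a function on all sets of naturals that
   vanishes off [X]^m (nsets X m, from HOL-Library.Ramsey). *)

type_synonym set_fun = "nat set \<Rightarrow> complex"

definition fscale :: "complex \<Rightarrow> set_fun \<Rightarrow> set_fun" where
  "fscale c f = (\<lambda>Z. c * f Z)"

interpretation fun_vs: vector_space fscale
  by unfold_locales (auto simp: fscale_def fun_eq_iff algebra_simps)

(* M n m is the permutation module M^{n-m,m}. *)
definition M :: "nat \<Rightarrow> nat \<Rightarrow> set_fun set" where
  "M n m = {f. \<forall>Z. Z \<notin> nsets {1..n} m \<longrightarrow> f Z = 0}"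

definition inner_M :: "nat \<Rightarrow> nat \<Rightarrow> set_fun \<Rightarrow> set_fun \<Rightarrow> complex" where
  "inner_M n m f g = (\<Sum>Z\<in>nsets {1..n} m. f Z * cnj (g Z))"

definition perm_act :: "(nat \<Rightarrow> nat) \<Rightarrow> set_fun \<Rightarrow> set_fun" where
  "perm_act \<pi> f = (\<lambda>Z. f (inv \<pi> ` Z))"

definition orthogonal_basis :: "nat \<Rightarrow> nat \<Rightarrow> set_fun set \<Rightarrow> set_fun set \<Rightarrow> bool" where
  "orthogonal_basis n m B V \<longleftrightarrow>
     pairwise (\<lambda>f g. inner_M n m f g = 0) B \<and> fun_vs.independent B \<and> fun_vs.span B = V"

definition sigma :: "nat \<Rightarrow> nat set \<Rightarrow> set_fun" where
  "sigma s X = (\<lambda>Z. if Z \<in> nsets X s then 1 else 0)"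

(* F is a function on the p-subsets of X and G one on the q-subsets of Y, with X, Y disjoint. *)
definition tensor :: "nat set \<Rightarrow> nat \<Rightarrow> set_fun \<Rightarrow> nat set \<Rightarrow> nat \<Rightarrow> set_fun \<Rightarrow> set_fun" where
  "tensor X p F Y q G =
     (\<lambda>Z. if Z \<in> nsets (X \<union> Y) (p + q) \<and> card (Z \<inter> X) = p then F (Z \<inter> X) * G (Z \<inter> Y) else 0)"

definition composition :: "nat list \<Rightarrow> nat \<Rightarrow> bool" where
  "composition a n \<longleftrightarrow> (\<forall>x\<in>set a. 0 < x) \<and> sum_list a = n"

(* Parts are numbered from 0, so block a r is the set A_{r+1}. *)
definition block :: "nat list \<Rightarrow> nat \<Rightarrow> nat set" where
  "block a r = {sum_list (take r a) + 1 .. sum_list (take (Suc r) a)}"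

definition young_subgroup :: "nat list \<Rightarrow> (nat \<Rightarrow> nat) set" where
  "young_subgroup a =
     {\<pi>. \<pi> permutes {1..sum_list a} \<and> (\<forall>r<length a. \<pi> ` block a r = block a r)}"

definition invariant_functions :: "nat list \<Rightarrow> nat \<Rightarrow> set_fun set" where
  "invariant_functions a m =
     {f \<in> M (sum_list a) m. \<forall>\<pi>\<in>young_subgroup a. perm_act \<pi> f = f}"

(* Planar binary trees in which every vertex, leaves included, carries a label. *)
datatype 'l bintree =
    Leaf (label: 'l)
  | Node (left_son: "'l bintree") (label: 'l) (right_son: "'l bintree")

type_synonym plane_tree = "unit bintree"

fun leaves :: "'l bintree \<Rightarrow> nat" where
  "leaves (Leaf k) = 1"
| "leaves (Node l k r) = leaves l + leaves r"

definition shape :: "'l bintree \<Rightarrow> plane_tree" where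
  "shape L = map_bintree (\<lambda>_. ()) L"

(* In the definitions below p is the number of leaves of the whole tree lying to the left of
   the given subtree, so that the leaves of the subtree carry the parts p, p+1, ... of a
   (numbered from 0). *)

definition weight :: "nat list \<Rightarrow> nat \<Rightarrow> 'l bintree \<Rightarrow> nat" where
  "weight a p L = (\<Sum>r = p..<p + leaves L. a ! r)"

definition support :: "nat list \<Rightarrow> nat \<Rightarrow> 'l bintree \<Rightarrow> nat set" where
  "support a p L = (\<Union>r\<in>{p..<p + leaves L}. block a r)"

fun vertex_conditions :: "nat list \<Rightarrow> nat \<Rightarrow> nat bintree \<Rightarrow> bool" where
  "vertex_conditions a p (Leaf k) \<longleftrightarrow> k = 0"
| "vertex_conditions a p (Node l k r) \<longleftrightarrow>
     (let q = p + leaves l;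
          i = label l; j = label r;
          Nl = weight a p l; Nr = weight a q r
      in real i \<le> real Nl / 2 \<and> real j \<le> real Nr / 2 \<and>
         int k - int Nl \<le> int j - int i \<and> int j - int i \<le> int Nr - int k \<and>
         i + j \<le> k \<and>
         vertex_conditions a p l \<and> vertex_conditions a q r)"

definition representation_labeling :: "plane_tree \<Rightarrow> nat list \<Rightarrow> nat \<Rightarrow> nat bintree \<Rightarrow> bool" where
  "representation_labeling T a m L \<longleftrightarrow>
     shape L = T \<and> vertex_conditions a 0 L \<and> label L \<le> min m (sum_list a - m)"

(* E_m(a,b,c,x). *)
definition hahn_E :: "int \<Rightarrow> int \<Rightarrow> int \<Rightarrow> int \<Rightarrow> int \<Rightarrow> int" where
  "hahn_E m a b c x =
     (\<Sum>r = max 0 (x - c + m)..min m x.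
        (- 1) ^ nat r * int (nat m choose nat r)
        * pochhammer (b - m + 1) (nat r) * pochhammer (- x) (nat r)
        * pochhammer (a - m + 1) (nat (m - r)) * pochhammer (x - c) (nat (m - r)))"

(* In the Node case n = Nl + Nr, and Nl, Nr are the quantities written a_1 + ... + a_t and
   n - (a_1 + ... + a_t). The bounds of w may be negative before taking max and min, hence the
   integers; within the range of summation both w and m - w are nonnegative. *)
fun \<Phi> :: "nat list \<Rightarrow> nat \<Rightarrow> nat bintree \<Rightarrow> nat \<Rightarrow> set_fun" where
  "\<Phi> a p (Leaf k) m = sigma m (block a p)"
| "\<Phi> a p (Node l k r) m =
     (let q = p + leaves l;
          i = int (label l); j = int (label r);
          Nl = int (weight a p l); Nr = int (weight a q r)
      in (\<Sum>w = max j (i - Nl + int m)..min (Nr - j) (int m - i).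
            fscale (of_int (hahn_E (int k - i - j) (Nr - 2 * j) (Nl - 2 * i) (int m - i - j) (w - j)))
              (tensor (support a p l) (nat (int m - w)) (\<Phi> a p l (nat (int m - w)))
                      (support a q r) (nat w) (\<Phi> a q r (nat w)))))"

end

theory Submission
  imports Defs "HOL-Computational_Algebra.Polynomial"
begin

text \<open>
The statement reduces to classical facts about the Hahn polynomials \<open>x \<mapsto> E_m(a,b,c,x)\<close>,
used once at every internal vertex of the tree.

The polynomial \<open>E_m\<close> has degree \<open>m\<close>, and these polynomials are orthogonal for the
hypergeometric weight \<open>(a choose x) (b choose (c - x))\<close>. The reason is that the sum of the weight
times \<open>E_m(x)\<close> times \<open>(a - x) choose s\<close> can be evaluated termwise by Vandermonde's
identity and becomes an \<open>m\<close>-th finite difference of a polynomial of degree \<open>s\<close>; it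
vanishes for \<open>s < m\<close>. The case \<open>s = m\<close> shows in addition that the squared norm of
\<open>E_m\<close> is a nonzero constant, independent of \<open>c\<close>, times \<open>(a + b - 2 m) choose (c
- m)\<close>.

This shape of the norm is what the recursion for \<open>\<Phi>\<close> needs. Claim (\<open>inner_Phi\<close>):
for labelings \<open>L\<close> and \<open>L'\<close> of the same tree the inner product of \<open>\<Phi> L
m\<close> and \<open>\<Phi> L' m\<close> is zero for \<open>L \<noteq> L'\<close>, and for \<open>L = L'\<close>
it is a nonzero constant, independent of \<open>m\<close>, times \<open>(N - 2 k) choose (m - k)\<close>, where
\<open>N\<close> is the weight and \<open>k\<close> the label of the root. Indeed, inner products of tensors are
products of inner products; by induction the norms of the sons with labels \<open>i\<close> and \<open>j\<close>
and weights \<open>Nl\<close> and \<open>Nr\<close> multiply to \<open>((Nl - 2 i) choose (m - w - i)) ((Nr - 2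
j) choose (w - j))\<close>, up to constants, which is the hypergeometric weight at \<open>x = w - j\<close>.
Orthogonality of the Hahn polynomials separates different root labels \<open>k\<close>, and their norms
reproduce the claim at the root. So the functions \<open>\<Phi>\<close> are orthogonal and nonzero, hence
independent.

For the span (\<open>profile_ind_in_span\<close>), an invariant function depends only on the profile of a
subset, that is on the numbers of its points in the blocks, and the indicator of a profile is an iterated tensor
product along the tree. At each vertex, the number of possible root labels \<open>k\<close> over given sons
equals the number of possible sizes \<open>w\<close>, and polynomials of degree at most \<open>d\<close> take
arbitrary values at \<open>d + 1\<close> points; hence the functions \<open>\<Phi>\<close> with varying
\<open>k\<close> span the same space as the tensor products with varying \<open>w\<close>.
\<close>

section \<open>Hahn polynomials\<close>

text \<open>The left-hand side is the \<open>m\<close>-th finite difference of the function \<open>r \<mapsto> (a - r)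
choose s\<close>, a polynomial of degree \<open>s\<close> in \<open>r\<close>: it vanishes for \<open>s <
m\<close> and is \<open>m!\<close> times the leading coefficient, up to sign, for \<open>s = m\<close>. One
difference, by Pascal's rule, lowers \<open>m\<close>, \<open>a\<close> and \<open>s\<close> by one each, which
is the induction below.\<close>

lemma alternating_binomial_sum:
  assumes "m \<le> a" "s \<le> m"
  shows "(\<Sum>r\<le>m. (-1) ^ r * of_nat (m choose r) * of_nat ((a - r) choose s))
       = (if s = m then 1 else 0 :: 'a::comm_ring_1)"
  using assms
proof (induction m arbitrary: a s)
  case 0
  then show ?case by simp
next
  case (Suc m)
  let ?f = "\<lambda>r. of_nat ((a - r) choose s) :: 'a"
  have "(\<Sum>r\<le>Suc m. (-1) ^ r * of_nat (Suc m choose r) * ?f r)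
      = ?f 0 + (\<Sum>r\<le>m. (-1) ^ Suc r * of_nat (Suc m choose Suc r) * ?f (Suc r))"
    by (subst sum.atMost_Suc_shift) simp
  also have "(\<Sum>r\<le>m. (-1) ^ Suc r * of_nat (Suc m choose Suc r) * ?f (Suc r))
      = (\<Sum>r\<le>m. (-1) ^ Suc r * of_nat (m choose Suc r) * ?f (Suc r))
        - (\<Sum>r\<le>m. (-1) ^ r * of_nat (m choose r) * ?f (Suc r))"
    unfolding sum_subtractf [symmetric] by (intro sum.cong refl) (simp add: algebra_simps)
  also have "?f 0 + ((\<Sum>r\<le>m. (-1) ^ Suc r * of_nat (m choose Suc r) * ?f (Suc r))
        - (\<Sum>r\<le>m. (-1) ^ r * of_nat (m choose r) * ?f (Suc r)))
      = (\<Sum>r\<le>Suc m. (-1) ^ r * of_nat (m choose r) * ?f r)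
        - (\<Sum>r\<le>m. (-1) ^ r * of_nat (m choose r) * ?f (Suc r))"
    by (subst sum.atMost_Suc_shift) simp
  also have "\<dots> = (\<Sum>r\<le>m. (-1) ^ r * of_nat (m choose r) * (?f r - ?f (Suc r)))"
    by (simp add: sum_subtractf right_diff_distrib binomial_eq_0)
  finally have step: "(\<Sum>r\<le>Suc m. (-1) ^ r * of_nat (Suc m choose r) * ?f r)
      = (\<Sum>r\<le>m. (-1) ^ r * of_nat (m choose r) * (?f r - ?f (Suc r)))" .
  show ?case
  proof (cases s)
    case 0
    then show ?thesis using step by simp
  next
    case (Suc s')
    have "?f r - ?f (Suc r) = of_nat ((a - 1 - r) choose s')" if "r \<le> m" for r
    proof -
      obtain d where "a - r = Suc d"
        using \<open>Suc m \<le> a\<close> \<open>r \<le> m\<close> by (cases "a - r") auto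
      moreover from this have "a - Suc r = d" "a - 1 - r = d" by auto
      ultimately show ?thesis using Suc by simp
    qed
    then have "(\<Sum>r\<le>Suc m. (-1) ^ r * of_nat (Suc m choose r) * ?f r)
      = (\<Sum>r\<le>m. (-1) ^ r * of_nat (m choose r) * of_nat ((a - 1 - r) choose s'))"
      unfolding step by (intro sum.cong) auto
    also have "\<dots> = (if s' = m then 1 else 0)"
      using Suc.prems Suc by (intro Suc.IH) auto
    finally show ?thesis using Suc by simp
  qed
qed

text \<open>Both sides count the pairs of disjoint subsets of sizes \<open>y\<close> and \<open>s\<close> of an
\<open>n\<close>-set.\<close>

lemma binomial_choose_disjoint_commute:
  "(n choose y) * ((n - y) choose s) = (n choose s) * ((n - s) choose y)"
proof (cases "y + s \<le> n")
  case True
  have "(n choose (y + s)) * ((y + s) choose y) = (n choose y) * ((n - y) choose s)"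
    using choose_mult[OF le_add1 True] by simp
  moreover have "(n choose (y + s)) * ((y + s) choose s) = (n choose s) * ((n - s) choose y)"
    using choose_mult[OF le_add2 True] by simp
  moreover have "(y + s) choose y = (y + s) choose s"
    using binomial_symmetric[of y "y + s"] by simp
  ultimately show ?thesis by metis
next
  case False
  then have "n < y \<or> n - y < s" "n < s \<or> n - s < y" by linarith+
  then show ?thesis by (metis binomial_eq_0 mult_zero_left mult_zero_right)
qed

text \<open>Factorial moments of the hypergeometric weight. In subsets, with disjoint sets of \<open>a\<close> and
\<open>b\<close> points: the sum counts the ways to choose a \<open>c\<close>-subset of the union, together with
\<open>r\<close> of its points in the first set, \<open>t\<close> of its points in the second set, and
\<open>s\<close> points of the first set outside it. One may fix the three marked sets first; what is left to
choose is a subset of size \<open>c - r - t\<close> among the \<open>a + b - s - r - t\<close> unmarked points,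
and this is Vandermonde's identity. The point of mixing choices inside and outside the subset is that the result
depends on \<open>r\<close> and \<open>t\<close> only in a way that the coefficients of the Hahn polynomials
cancel.\<close>

lemma hypergeometric_moment:
  assumes "r \<le> a" "t \<le> b" "r + t \<le> c"
  shows "(\<Sum>x\<le>c. (a choose x) * (b choose (c - x)) * (x choose r) * ((c - x) choose t) * ((a - x) choose s))
       = (a choose r) * ((a - r) choose s) * (b choose t) * ((a + b - s - r - t) choose (c - r - t))"
proof (cases "r + s \<le> a")
  case False
  have "(a choose x) * (x choose r) * ((a - x) choose s) = 0" for x
    using False by (cases "x < r"; cases "a < x") auto
  moreover have "(a choose x) * (b choose (c - x)) * (x choose r) * ((c - x) choose t) * ((a - x) choose s)
      = ((a choose x) * (x choose r) * ((a - x) choose s)) * ((b choose (c - x)) * ((c - x) choose t))" for x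
    by (simp only: ac_simps)
  ultimately have "(a choose x) * (b choose (c - x)) * (x choose r) * ((c - x) choose t) * ((a - x) choose s) = 0" for x
    by (simp only: mult_zero_left)
  then have "(\<Sum>x\<le>c. (a choose x) * (b choose (c - x)) * (x choose r) * ((c - x) choose t) * ((a - x) choose s)) = 0"
    by simp
  moreover have "(a - r) choose s = 0" using False assms(1) by simp
  ultimately show ?thesis by (simp only: mult_zero_left mult_zero_right)
next
  case True
  let ?g = "\<lambda>x. (a choose x) * (b choose (c - x)) * (x choose r) * ((c - x) choose t) * ((a - x) choose s)"
  have shift: "?g (r + y) = (a choose r) * ((a - r) choose s) * (b choose t)
        * (((a - r - s) choose y) * ((b - t) choose (c - r - t - y)))" if "y \<le> c - r - t" for y
  proof -
    have A: "(a choose (r + y)) * ((r + y) choose r) = (a choose r) * ((a - r) choose y)"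
    proof (cases "r + y \<le> a")
      case True
      from choose_mult[OF le_add1 True] show ?thesis by simp
    next
      case False
      then have "a < r + y" "a - r < y" using assms(1) by arith+
      then show ?thesis by (simp only: binomial_eq_0 mult_zero_left mult_zero_right)
    qed
    have B: "((a - r) choose y) * ((a - r - y) choose s) = ((a - r) choose s) * ((a - r - s) choose y)"
      by (rule binomial_choose_disjoint_commute)
    have C: "(b choose (c - (r + y))) * ((c - (r + y)) choose t) = (b choose t) * ((b - t) choose (c - r - t - y))"
    proof (cases "c - (r + y) \<le> b")
      case True
      have "t \<le> c - (r + y)" using that assms by arith
      from choose_mult[OF this True] show ?thesis by (simp add: ac_simps)
    next
      case False
      then have "b < c - (r + y)" "b - t < c - r - t - y" using assms that by arith+
      then show ?thesis by (simp only: binomial_eq_0 mult_zero_left mult_zero_right)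
    qed
    have "?g (r + y) = ((a choose (r + y)) * ((r + y) choose r)) * ((b choose (c - (r + y))) * ((c - (r + y)) choose t))
        * ((a - r - y) choose s)" by (simp add: ac_simps)
    also have "\<dots> = (a choose r) * (((a - r) choose y) * ((a - r - y) choose s)) * ((b choose t) * ((b - t) choose (c - r - t - y)))"
      unfolding A C by (simp add: ac_simps)
    finally show ?thesis unfolding B by (simp add: ac_simps)
  qed
  have "(\<Sum>x\<le>c. ?g x) = (\<Sum>x\<in>{r..c - t}. ?g x)"
  proof (intro sum.mono_neutral_right ballI)
    fix x assume "x \<in> {..c} - {r..c - t}"
    then have "x < r \<or> c - x < t" using assms by auto
    then show "?g x = 0" by auto
  qed auto
  also have "\<dots> = (\<Sum>y\<le>c - r - t. ?g (r + y))"
    by (rule sum.reindex_bij_witness[of _ "\<lambda>y. r + y" "\<lambda>x. x - r"]) (use assms in auto)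
  also have "\<dots> = (\<Sum>y\<le>c - r - t. (a choose r) * ((a - r) choose s) * (b choose t)
        * (((a - r - s) choose y) * ((b - t) choose (c - r - t - y))))"
    by (intro sum.cong refl shift) auto
  also have "\<dots> = (a choose r) * ((a - r) choose s) * (b choose t) * ((a - r - s + (b - t)) choose (c - r - t))"
    unfolding sum_distrib_left[symmetric] vandermonde ..
  also have "a - r - s + (b - t) = a + b - s - r - t" using True assms by simp
  finally show ?thesis .
qed

lemma pochhammer_minus_of_nat:
  "pochhammer (- of_nat x) r = (-1) ^ r * fact r * (of_nat (x choose r) :: 'a::field_char_0)"
  by (simp add: binomial_gbinomial gbinomial_pochhammer flip: power_mult_distrib)

lemma poly_pochhammer: "poly (pochhammer p r) x = pochhammer (poly p x) r"
  by (induction r) (simp_all add: pochhammer_Suc)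

lemma degree_coeff_pochhammer_linear:
  fixes c d :: "'a::idom"
  assumes "d \<noteq> 0"
  shows "degree (pochhammer [:c, d:] r) = r \<and> coeff (pochhammer [:c, d:] r) r = d ^ r"
proof (induction r)
  case (Suc r)
  have lin: "[:c, d:] + of_nat r = [:c + of_nat r, d:]" by (simp add: of_nat_poly)
  have nz: "pochhammer [:c, d:] r \<noteq> 0" using Suc assms by auto
  have "degree (pochhammer [:c, d:] (Suc r)) = Suc r"
    unfolding pochhammer_Suc lin using Suc nz assms by (subst degree_mult_eq) auto
  moreover have "coeff (pochhammer [:c, d:] (Suc r)) (Suc r) = d ^ Suc r"
    unfolding pochhammer_Suc lin
    using coeff_mult_degree_sum[of "pochhammer [:c, d:] r" "[:c + of_nat r, d:]"] Suc assms by simp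
  ultimately show ?case ..
qed auto

text \<open>A sequence of polynomials of degrees \<open>0, 1, \<dots>, d\<close> spans the polynomials of degree at most
\<open>d\<close>. This is used twice: with falling factorials, to test orthogonality against all polynomials of
small degree, and with the Hahn polynomials themselves, to obtain completeness.\<close>

lemma poly_graded_basis:
  fixes q :: "nat \<Rightarrow> 'a::field poly"
  assumes "\<And>s. s \<le> d \<Longrightarrow> degree (q s) \<le> s" "\<And>s. s \<le> d \<Longrightarrow> coeff (q s) s \<noteq> 0" "degree p \<le> d"
  obtains c where "p = (\<Sum>s\<le>d. smult (c s) (q s))" "coeff p d = c d * coeff (q d) d"
proof -
  have "\<exists>c. p = (\<Sum>s\<le>d. smult (c s) (q s))"
    using assms
  proof (induction d arbitrary: p)
    case 0
    define u where "u = coeff p 0 / coeff (q 0) 0"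
    have "p = [:coeff p 0:]" "q 0 = [:coeff (q 0) 0:]"
      using 0 by (metis le_zero_eq order_refl coeff_pCons_0 degree_eq_zeroE)+
    then have "p = smult u (q 0)"
      using 0 unfolding u_def by (metis nonzero_eq_divide_eq order_refl smult_pCons smult_0_right)
    then show ?case by auto
  next
    case (Suc d)
    define u where "u = coeff p (Suc d) / coeff (q (Suc d)) (Suc d)"
    define p' where "p' = p - smult u (q (Suc d))"
    have "coeff p' i = 0" if "i > d" for i
    proof (cases "i = Suc d")
      case True
      then show ?thesis using Suc.prems by (simp add: p'_def u_def)
    next
      case False
      then have "degree p < i" "degree (q (Suc d)) < i"
        using that Suc.prems(1)[of "Suc d"] Suc.prems(3) by auto
      then show ?thesis by (simp add: p'_def coeff_eq_0)
    qed
    then have "degree p' \<le> d" by (intro degree_le) auto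
    then obtain c where "p' = (\<Sum>s\<le>d. smult (c s) (q s))"
      using Suc.IH[of p'] Suc.prems by auto
    then have "p = (\<Sum>s\<le>d. smult (c s) (q s)) + smult u (q (Suc d))"
      by (simp add: p'_def algebra_simps)
    then have "p = (\<Sum>s\<le>Suc d. smult ((c(Suc d := u)) s) (q s))"
      by simp
    then show ?case by blast
  qed
  then obtain c where c: "p = (\<Sum>s\<le>d. smult (c s) (q s))" by blast
  have "coeff p d = (\<Sum>s\<le>d. c s * coeff (q s) d)"
    unfolding c by (simp add: coeff_sum)
  also have "\<dots> = (\<Sum>s\<le>d. if s = d then c d * coeff (q d) d else 0)"
  proof (intro sum.cong refl)
    fix s assume s: "s \<in> {..d}"
    show "c s * coeff (q s) d = (if s = d then c d * coeff (q d) d else 0)"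
      using s assms(1)[of s] by (auto simp: coeff_eq_0)
  qed
  finally show ?thesis using that c by simp
qed

text \<open>The numbers \<open>E_m(a,b,c,x)\<close> as values of one polynomial in \<open>x\<close>. The index
\<open>r\<close> runs over the full range \<open>0..m\<close>, without the bounds depending on \<open>x\<close>:
at integers \<open>x\<close> between \<open>0\<close> and \<open>c\<close> the additional terms vanish, and only
so are degree and leading coefficient visible. The parameters \<open>b - m + 1\<close> and \<open>a - m +
1\<close> are written with natural subtraction, so the polynomial is the intended one for \<open>m \<le>
a\<close> and \<open>m \<le> b\<close>.\<close>

definition hahn_poly :: "nat \<Rightarrow> nat \<Rightarrow> nat \<Rightarrow> nat \<Rightarrow> complex poly" where
  "hahn_poly m a b c =
     (\<Sum>r\<le>m. smult ((-1) ^ r * of_nat (m choose r)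
                      * pochhammer (1 + of_nat (b - m)) r * pochhammer (1 + of_nat (a - m)) (m - r))
              (pochhammer [:0, -1:] r * pochhammer [:- of_nat c, 1:] (m - r)))"

lemma hahn_E_eq_poly:
  assumes "m \<le> a" "m \<le> b" "x \<le> c"
  shows "of_int (hahn_E (int m) (int a) (int b) (int c) (int x)) = poly (hahn_poly m a b c) (of_nat x)"
proof -
  define f :: "int \<Rightarrow> int" where "f = (\<lambda>r.
        (- 1) ^ nat r * int (nat (int m) choose nat r)
        * pochhammer (int b - int m + 1) (nat r) * pochhammer (- int x) (nat r)
        * pochhammer (int a - int m + 1) (nat (int m - r)) * pochhammer (int x - int c) (nat (int m - r)))"
  have zero: "f (int r) = 0" if "r \<le> m" "int r \<notin> {max 0 (int x - int c + int m)..min (int m) (int x)}" for r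
  proof -
    have "x < r \<or> c - x < m - r" using that assms by auto
    then show ?thesis
    proof
      assume "x < r"
      then show ?thesis by (simp add: f_def pochhammer_of_nat_eq_0_lemma)
    next
      assume *: "c - x < m - r"
      have eq: "int x - int c = - int (c - x)" "nat (int m - int r) = m - r" using assms by simp_all
      have "pochhammer (int x - int c) (nat (int m - int r)) = 0"
        unfolding eq by (rule pochhammer_of_nat_eq_0_lemma[OF *])
      then show ?thesis unfolding f_def by (simp only: mult_zero_right)
    qed
  qed
  have "hahn_E (int m) (int a) (int b) (int c) (int x)
      = (\<Sum>r\<in>{max 0 (int x - int c + int m)..min (int m) (int x)}. f r)"
    by (simp add: hahn_E_def f_def)
  also have "\<dots> = (\<Sum>r\<in>int ` {..m}. f r)"
  proof (intro sum.mono_neutral_left ballI)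
    show "{max 0 (int x - int c + int m)..min (int m) (int x)} \<subseteq> int ` {..m}"
    proof
      fix y assume "y \<in> {max 0 (int x - int c + int m)..min (int m) (int x)}"
      then have "y = int (nat y)" "nat y \<le> m" by auto
      then show "y \<in> int ` {..m}" by blast
    qed
  qed (use zero in auto)
  also have "\<dots> = (\<Sum>r\<le>m. f (int r))"
    by (subst sum.reindex) auto
  finally have E: "hahn_E (int m) (int a) (int b) (int c) (int x) = (\<Sum>r\<le>m. f (int r))" .
  have "complex_of_int (f (int r)) = (-1) ^ r * of_nat (m choose r)
          * pochhammer (1 + of_nat (b - m)) r * pochhammer (1 + of_nat (a - m)) (m - r)
          * (pochhammer (- of_nat x) r * pochhammer (of_nat x - of_nat c) (m - r))" if "r \<le> m" for r
  proof -
    have "nat (int m - int r) = m - r" by simp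
    then show ?thesis
      using assms by (simp add: f_def of_nat_diff algebra_simps flip: pochhammer_of_int)
  qed
  then show ?thesis
    unfolding E hahn_poly_def by (simp add: poly_sum poly_pochhammer algebra_simps)
qed

text \<open>The leading coefficient is a Chu-Vandermonde sum: the two signs, from the coefficient of the \<open>r\<close>-th
term and from \<open>pochhammer [:0, -1:] r\<close>, cancel. Hence it is a rising factorial of a positive number
and does not vanish.\<close>

lemma hahn_poly_degree_coeff:
  assumes "m \<le> a" "m \<le> b"
  shows "degree (hahn_poly m a b c) \<le> m"
    and "coeff (hahn_poly m a b c) m = pochhammer (of_nat (a + b - 2 * m + 2)) m"
proof -
  let ?t = "\<lambda>r. pochhammer [:0, -1:] r * pochhammer [:- of_nat c, 1:] (m - r) :: complex poly"
  have deg: "degree (?t r) \<le> m" if "r \<le> m" for r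
    using degree_mult_le[of "pochhammer [:0, -1::complex:] r" "pochhammer [:- of_nat c, 1::complex:] (m - r)"] that
      degree_coeff_pochhammer_linear[of "-1::complex" 0 r]
      degree_coeff_pochhammer_linear[of "1::complex" "- of_nat c" "m - r"] by simp
  have lc: "coeff (?t r) m = (-1) ^ r" if "r \<le> m" for r
    using coeff_mult_degree_sum[of "pochhammer [:0, -1::complex:] r" "pochhammer [:- of_nat c, 1::complex:] (m - r)"] that
      degree_coeff_pochhammer_linear[of "-1::complex" 0 r]
      degree_coeff_pochhammer_linear[of "1::complex" "- of_nat c" "m - r"] by simp
  show "degree (hahn_poly m a b c) \<le> m"
    unfolding hahn_poly_def
    by (intro degree_sum_le order_trans[OF degree_smult_le] deg) auto
  have "coeff (hahn_poly m a b c) m = (\<Sum>r\<le>m. of_nat (m choose r)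
                      * pochhammer (1 + of_nat (b - m)) r * pochhammer (1 + of_nat (a - m)) (m - r))"
    unfolding hahn_poly_def coeff_sum coeff_smult
  proof (intro sum.cong refl)
    fix r assume "r \<in> {..m}"
    then have "coeff (?t r) m = (-1) ^ r" using lc by simp
    moreover have "(-1) ^ r * (-1) ^ r = (1::complex)" by (simp flip: power_mult_distrib)
    ultimately show "(-1) ^ r * of_nat (m choose r)
                      * pochhammer (1 + of_nat (b - m)) r * pochhammer (1 + of_nat (a - m)) (m - r) * coeff (?t r) m
        = of_nat (m choose r)
                      * pochhammer (1 + of_nat (b - m)) r * pochhammer (1 + of_nat (a - m)) (m - r)"
      by simp
  qed
  also have "\<dots> = pochhammer ((1 + of_nat (b - m)) + (1 + of_nat (a - m))) m"
    by (rule pochhammer_binomial_sum[symmetric])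
  also have "(1 + of_nat (b - m)) + (1 + of_nat (a - m)) = (of_nat (a + b - 2 * m + 2) :: complex)"
  proof -
    have "a + b - 2 * m + 2 = Suc (b - m) + Suc (a - m)" using assms by simp
    then show ?thesis by simp
  qed
  finally show "coeff (hahn_poly m a b c) m = pochhammer (of_nat (a + b - 2 * m + 2)) m" .
qed

lemma hahn_poly_coeff_nonzero:
  assumes "m \<le> a" "m \<le> b"
  shows "coeff (hahn_poly m a b c) m \<noteq> 0"
proof -
  have "a + b - 2 * m + 2 = Suc (a + b - 2 * m + 1)" by simp
  then show ?thesis
    unfolding hahn_poly_degree_coeff(2)[OF assms]
    using pochhammer_pos[of "a + b - 2 * m + 2" m]
    by (simp only: pochhammer_of_nat of_nat_eq_0_iff) simp
qed

text \<open>For \<open>m \<le> a\<close> this is the falling factorial \<open>a (a - 1) \<cdots> (a - m + 1)\<close>.\<close>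

definition ffact :: "nat \<Rightarrow> nat \<Rightarrow> complex" where
  "ffact a m = fact a / fact (a - m)"

text \<open>The Pochhammer symbols in the coefficients of the Hahn polynomials complete the falling factorials \<open>r! (a
choose r)\<close> produced by the moments to length \<open>m\<close>, so that no dependence on \<open>r\<close>
remains.\<close>

lemma ffact_absorb:
  assumes "m \<le> a" "r \<le> m"
  shows "pochhammer (1 + of_nat (a - m)) (m - r) * fact r * of_nat (a choose r) = ffact a m"
proof -
  have "fact (a - m + (m - r)) = (fact (a - m) * pochhammer (1 + of_nat (a - m)) (m - r) :: complex)"
    unfolding pochhammer_fact by (rule pochhammer_product')
  moreover have "a - m + (m - r) = a - r" using assms by simp
  ultimately have "pochhammer (1 + of_nat (a - m)) (m - r) = (fact (a - r) / fact (a - m) :: complex)"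
    by (simp add: field_simps)
  moreover have "of_nat (a choose r) = (fact a / (fact r * fact (a - r)) :: complex)"
    using assms by (intro binomial_fact) simp
  ultimately show ?thesis by (simp add: ffact_def)
qed

text \<open>By \<open>hypergeometric_moment\<close> and \<open>ffact_absorb\<close> each term of the Hahn polynomial
contributes a constant independent of \<open>r\<close> times \<open>(-1) ^ r (m choose r) ((a - r) choose
s)\<close>, so the sum over \<open>r\<close> is a finite difference of order \<open>m\<close>. The test
polynomial is a multiple of \<open>(a - x) choose s\<close>.\<close>

lemma hahn_poly_moment:
  assumes "m \<le> a" "m \<le> b" "m \<le> c" "s \<le> m"
  shows "(\<Sum>x\<le>c. of_nat (a choose x) * of_nat (b choose (c - x)) * poly (hahn_poly m a b c) (of_nat x)
            * poly (pochhammer [:- of_nat a, 1:] s) (of_nat x))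
       = (if s = m then ffact a m * ffact b m * fact m * of_nat ((a + b - 2 * m) choose (c - m)) else 0)"
proof -
  define K where "K = (\<lambda>r. (-1) ^ r * of_nat (m choose r)
          * pochhammer (1 + of_nat (b - m)) r * pochhammer (1 + of_nat (a - m)) (m - r) :: complex)"
  define G where "G = (\<lambda>r x. (a choose x) * (b choose (c - x)) * (x choose r) * ((c - x) choose (m - r)) * ((a - x) choose s))"
  have "(\<Sum>x\<le>c. of_nat (a choose x) * of_nat (b choose (c - x)) * poly (hahn_poly m a b c) (of_nat x)
            * poly (pochhammer [:- of_nat a, 1:] s) (of_nat x))
      = (\<Sum>x\<le>c. \<Sum>r\<le>m. (-1) ^ (m + s) * fact s * (K r * fact r * fact (m - r)) * of_nat (G r x))"
  proof (intro sum.cong refl)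
    fix x assume x: "x \<in> {..c}"
    have q: "of_nat (a choose x) * poly (pochhammer [:- of_nat a, 1:] s) (of_nat x :: complex)
        = of_nat (a choose x) * ((-1) ^ s * fact s * of_nat ((a - x) choose s))"
    proof (cases "x \<le> a")
      case True
      then have "of_nat x - of_nat a = (- of_nat (a - x) :: complex)" by (simp add: of_nat_diff)
      then show ?thesis by (simp add: poly_pochhammer pochhammer_minus_of_nat)
    qed simp
    have p: "poly (hahn_poly m a b c) (of_nat x) = (\<Sum>r\<le>m. (-1) ^ m * (K r * fact r * fact (m - r))
              * (of_nat (x choose r) * of_nat ((c - x) choose (m - r))))"
      unfolding hahn_poly_def poly_sum
    proof (intro sum.cong refl)
      fix r assume r: "r \<in> {..m}"
      have "of_nat x - of_nat c = (- of_nat (c - x) :: complex)" using x by (simp add: of_nat_diff)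
      moreover have "(-1) ^ m = ((-1) ^ r * (-1) ^ (m - r) :: complex)" using r by (simp flip: power_add)
      ultimately show "poly (smult ((-1) ^ r * of_nat (m choose r)
                      * pochhammer (1 + of_nat (b - m)) r * pochhammer (1 + of_nat (a - m)) (m - r))
              (pochhammer [:0, -1:] r * pochhammer [:- of_nat c, 1:] (m - r))) (of_nat x)
         = (-1) ^ m * (K r * fact r * fact (m - r)) * (of_nat (x choose r) * of_nat ((c - x) choose (m - r)))"
        by (simp add: poly_pochhammer pochhammer_minus_of_nat K_def)
    qed
    have "of_nat (a choose x) * of_nat (b choose (c - x)) * poly (hahn_poly m a b c) (of_nat x)
            * poly (pochhammer [:- of_nat a, 1:] s) (of_nat x)
        = of_nat (b choose (c - x)) * poly (hahn_poly m a b c) (of_nat x) *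
            (of_nat (a choose x) * poly (pochhammer [:- of_nat a, 1:] s) (of_nat x))"
      by (simp add: ac_simps)
    also have "\<dots> = (\<Sum>r\<le>m. (-1) ^ (m + s) * fact s * (K r * fact r * fact (m - r)) * of_nat (G r x))"
      unfolding q p by (simp add: sum_distrib_left sum_distrib_right G_def power_add ac_simps)
    finally show "of_nat (a choose x) * of_nat (b choose (c - x)) * poly (hahn_poly m a b c) (of_nat x)
            * poly (pochhammer [:- of_nat a, 1:] s) (of_nat x)
        = (\<Sum>r\<le>m. (-1) ^ (m + s) * fact s * (K r * fact r * fact (m - r)) * of_nat (G r x))" .
  qed
  also have "\<dots> = (\<Sum>r\<le>m. (-1) ^ (m + s) * fact s * (K r * fact r * fact (m - r)) * of_nat (\<Sum>x\<le>c. G r x))"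
    by (subst sum.swap) (simp add: sum_distrib_left)
  also have "\<dots> = (\<Sum>r\<le>m. (-1) ^ (m + s) * fact s * ffact a m * ffact b m * of_nat ((a + b - s - m) choose (c - m))
        * ((-1) ^ r * of_nat (m choose r) * of_nat ((a - r) choose s)))"
  proof (intro sum.cong refl)
    fix r assume "r \<in> {..m}"
    then have r: "r \<le> m" by simp
    have "(\<Sum>x\<le>c. G r x) = (a choose r) * ((a - r) choose s) * (b choose (m - r)) * ((a + b - s - r - (m - r)) choose (c - r - (m - r)))"
      unfolding G_def by (rule hypergeometric_moment) (use assms r in auto)
    moreover have "a + b - s - r - (m - r) = a + b - s - m" "c - r - (m - r) = c - m" using r by auto
    ultimately have G: "(\<Sum>x\<le>c. G r x) = (a choose r) * ((a - r) choose s) * (b choose (m - r)) * ((a + b - s - m) choose (c - m))"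
      by simp
    have A: "pochhammer (1 + of_nat (a - m)) (m - r) * fact r * of_nat (a choose r) = ffact a m"
      using ffact_absorb assms r by blast
    have B: "pochhammer (1 + of_nat (b - m)) r * fact (m - r) * of_nat (b choose (m - r)) = ffact b m"
      using ffact_absorb[of m b "m - r"] assms r by simp
    show "(-1) ^ (m + s) * fact s * (K r * fact r * fact (m - r)) * of_nat (\<Sum>x\<le>c. G r x)
        = (-1) ^ (m + s) * fact s * ffact a m * ffact b m * of_nat ((a + b - s - m) choose (c - m))
        * ((-1) ^ r * of_nat (m choose r) * of_nat ((a - r) choose s))"
      unfolding G K_def A[symmetric] B[symmetric] by simp
  qed
  also have "\<dots> = (-1) ^ (m + s) * fact s * ffact a m * ffact b m * of_nat ((a + b - s - m) choose (c - m))
      * (if s = m then 1 else 0)"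
    unfolding sum_distrib_left[symmetric] using assms by (simp only: alternating_binomial_sum)
  finally show ?thesis by (auto simp: mult_2)
qed

text \<open>The functional \<open>p \<mapsto> \<Sum>x. weight * hahn_poly * p\<close> sees only the coefficient of degree
\<open>m\<close>, because it kills the test polynomials of degree less than \<open>m\<close>.\<close>

lemma hahn_poly_inner_product:
  assumes "m \<le> a" "m \<le> b" "m \<le> c" "degree p \<le> m"
  shows "(\<Sum>x\<le>c. of_nat (a choose x) * of_nat (b choose (c - x)) * poly (hahn_poly m a b c) (of_nat x) * poly p (of_nat x))
       = coeff p m * ffact a m * ffact b m * fact m * of_nat ((a + b - 2 * m) choose (c - m))"
proof -
  let ?q = "\<lambda>s. pochhammer [:- of_nat a, 1:] s :: complex poly"
  let ?h = "\<lambda>x. of_nat (a choose x) * of_nat (b choose (c - x)) * poly (hahn_poly m a b c) (of_nat x)"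
  obtain u where u: "p = (\<Sum>s\<le>m. smult (u s) (?q s))" "coeff p m = u m * coeff (?q m) m"
    by (rule poly_graded_basis[of m ?q p]) (use assms degree_coeff_pochhammer_linear[of "1::complex"] in auto)
  have "(\<Sum>x\<le>c. ?h x * poly p (of_nat x)) = (\<Sum>x\<le>c. \<Sum>s\<le>m. u s * (?h x * poly (?q s) (of_nat x)))"
    unfolding u(1) by (simp add: poly_sum sum_distrib_left ac_simps)
  also have "\<dots> = (\<Sum>s\<le>m. u s * (\<Sum>x\<le>c. ?h x * poly (?q s) (of_nat x)))"
    by (subst sum.swap) (simp add: sum_distrib_left)
  also have "\<dots> = (\<Sum>s\<le>m. u s * (if s = m then ffact a m * ffact b m * fact m * of_nat ((a + b - 2 * m) choose (c - m)) else 0))"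
    by (intro sum.cong refl arg_cong2[where f="(*)"] hahn_poly_moment) (use assms in auto)
  also have "\<dots> = u m * (ffact a m * ffact b m * fact m * of_nat ((a + b - 2 * m) choose (c - m)))"
    by (simp add: if_distrib cong: if_cong)
  finally show ?thesis
    using u(2) degree_coeff_pochhammer_linear[of "1::complex" "- of_nat a" m] by simp
qed

text \<open>The part of the squared norm of \<open>hahn_poly m a b c\<close> that does not depend on \<open>c\<close>. This
separation is what makes the norms of \<open>\<Phi>\<close> multiply along the tree.\<close>

definition hahn_norm :: "nat \<Rightarrow> nat \<Rightarrow> nat \<Rightarrow> complex" where
  "hahn_norm m a b = pochhammer (of_nat (a + b - 2 * m + 2)) m * ffact a m * ffact b m * fact m"

lemma hahn_norm_nonzero: "m \<le> a \<Longrightarrow> m \<le> b \<Longrightarrow> hahn_norm m a b \<noteq> 0"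
  using hahn_poly_coeff_nonzero[of m a b] hahn_poly_degree_coeff(2)[of m a b]
  by (simp add: hahn_norm_def ffact_def)

lemma hahn_poly_orthogonal:
  assumes "m \<le> a" "m \<le> b" "m \<le> c" "m' \<le> a" "m' \<le> b" "m' \<le> c"
  shows "(\<Sum>x\<le>c. of_nat (a choose x) * of_nat (b choose (c - x))
            * (poly (hahn_poly m a b c) (of_nat x) * poly (hahn_poly m' a b c) (of_nat x)))
       = (if m = m' then hahn_norm m a b * of_nat ((a + b - 2 * m) choose (c - m)) else 0)"
proof -
  have less: "(\<Sum>x\<le>c. of_nat (a choose x) * of_nat (b choose (c - x))
            * (poly (hahn_poly k a b c) (of_nat x) * poly (hahn_poly k' a b c) (of_nat x))) = 0"
    if "k' < k" "k \<le> a" "k \<le> b" "k \<le> c" for k k'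
  proof -
    have "degree (hahn_poly k' a b c) < k"
      using hahn_poly_degree_coeff(1)[of k' a b c] that by simp
    then show ?thesis
      using hahn_poly_inner_product[of k a b c "hahn_poly k' a b c"] that
      by (simp add: coeff_eq_0 mult.assoc)
  qed
  consider "m' < m" | "m < m'" | "m = m'" by linarith
  then show ?thesis
  proof cases
    case 1
    then show ?thesis using less assms by simp
  next
    case 2
    then show ?thesis using less[of m m'] assms by (simp add: mult.commute[of "poly (hahn_poly m a b c) _"])
  next
    case 3
    then show ?thesis
      using hahn_poly_inner_product[of m a b c "hahn_poly m a b c"] hahn_poly_degree_coeff[of m a b c] assms
      by (simp add: hahn_norm_def mult.assoc)
  qed
qed

text \<open>On at most \<open>d + 1\<close> points every function agrees with a polynomial of degree at most
\<open>d\<close>, and the Hahn polynomials of index at most \<open>d\<close> are a graded basis of these.\<close>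

lemma hahn_poly_complete:
  assumes "d \<le> a" "d \<le> b" "finite X" "x0 \<in> X" "card X \<le> Suc d"
  obtains u where "\<And>x. x \<in> X \<Longrightarrow> (\<Sum>k\<le>d. u k * poly (hahn_poly k a b c) (of_nat x)) = (if x = x0 then 1 else 0)"
proof -
  \<comment> \<open>the Lagrange polynomial with value 1 at \<open>x0\<close> and 0 at the other points of \<open>X\<close>\<close>
  define p :: "complex poly" where
    "p = (\<Prod>y\<in>X - {x0}. smult (1 / (of_nat x0 - of_nat y)) [:- of_nat y, 1:])"
  have "degree p \<le> (\<Sum>y\<in>X - {x0}. degree (smult (1 / (of_nat x0 - of_nat y)) [:- of_nat y, 1::complex:]))"
    unfolding p_def using degree_prod_sum_le[of "X - {x0}" "\<lambda>y. smult (1 / (of_nat x0 - of_nat y)) [:- of_nat y, 1::complex:]"] assms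
    by (simp add: comp_def)
  also have "\<dots> \<le> (\<Sum>y\<in>X - {x0}. 1)"
    by (intro sum_mono order_trans[OF degree_smult_le]) simp
  also have "\<dots> \<le> d" using assms by simp
  finally have "degree p \<le> d" .
  then obtain u where u: "p = (\<Sum>k\<le>d. smult (u k) (hahn_poly k a b c))"
    by (rule poly_graded_basis[of d "\<lambda>k. hahn_poly k a b c" p, rotated 2])
      (use assms in \<open>auto simp: hahn_poly_degree_coeff(1) hahn_poly_coeff_nonzero\<close>)
  have val: "poly p (of_nat x) = (if x = x0 then 1 else 0)" if "x \<in> X" for x
  proof (cases "x = x0")
    case True
    have "poly p (of_nat x0) = (\<Prod>y\<in>X - {x0}. 1)"
      unfolding p_def poly_prod by (intro prod.cong) (auto simp flip: diff_divide_distrib)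
    then show ?thesis using True by simp
  next
    case False
    then show ?thesis using that assms
      by (auto simp: p_def poly_prod intro!: prod_zero)
  qed
  show ?thesis
    by (rule that[of u]) (use u val in \<open>simp add: poly_sum\<close>)
qed

section \<open>Blocks and labelings of subtrees\<close>

lemma sum_list_take_mono:
  fixes a :: "nat list"
  assumes "r \<le> s"
  shows "sum_list (take r a) \<le> sum_list (take s a)"
proof -
  have "sum_list (take s a) = sum_list (take r (take s a)) + sum_list (drop r (take s a))"
    by (metis append_take_drop_id sum_list_append)
  then show ?thesis using assms by (simp add: min_absorb1)
qed

lemma sum_list_take_Suc: "r < length a \<Longrightarrow> sum_list (take (Suc r) a) = sum_list (take r a) + (a ! r :: nat)"
  by (simp add: take_Suc_conv_app_nth)

lemma disjoint_blocks: "r \<noteq> s \<Longrightarrow> block a r \<inter> block a s = {}"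
  using sum_list_take_mono[of "Suc r" s a] sum_list_take_mono[of "Suc s" r a]
  by (cases "r < s") (auto simp: block_def)

lemma finite_block [simp]: "finite (block a r)"
  by (simp add: block_def)

lemma card_block: "r < length a \<Longrightarrow> card (block a r) = a ! r"
  by (simp add: block_def sum_list_take_Suc)

lemma UN_blocks: "(\<Union>r\<in>{p..<p + h}. block a r) = {sum_list (take p a) + 1..sum_list (take (p + h) a)}"
proof (induction h)
  case (Suc h)
  have "(\<Union>r\<in>{p..<p + Suc h}. block a r) = (\<Union>r\<in>{p..<p + h}. block a r) \<union> block a (p + h)"
    by (simp add: atLeastLessThanSuc Un_commute)
  then show ?case
    using Suc sum_list_take_mono[of p "p + h" a] sum_list_take_mono[of "p + h" "Suc (p + h)" a]
    by (auto simp: block_def)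
qed auto

lemma finite_support [simp]: "finite (support a p L)"
  by (simp add: support_def)

lemma support_Leaf: "support a p (Leaf k) = block a p"
  by (simp add: support_def)

lemma support_Node: "support a p (Node l k r) = support a p l \<union> support a (p + leaves l) r"
  unfolding support_def UN_Un[symmetric]
  by (intro arg_cong2[where f="\<lambda>A f. \<Union> (f ` A)"]) auto

lemma support_disjoint: "support a p l \<inter> support a (p + leaves l) r = {}"
proof -
  have "block a s \<inter> block a s' = {}" if "s < p + leaves l" "p + leaves l \<le> s'" for s s'
    using that by (intro disjoint_blocks) simp
  then show ?thesis unfolding support_def by (auto simp: disjoint_iff)
qed

lemma support_root: "leaves L = length a \<Longrightarrow> support a 0 L = {1..sum_list a}"
  unfolding support_def using UN_blocks[of a 0 "length a"] by simp

lemma weight_Leaf: "weight a p (Leaf k) = a ! p"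
  by (simp add: weight_def)

lemma weight_Node: "weight a p (Node l k r) = weight a p l + weight a (p + leaves l) r"
  unfolding weight_def leaves.simps add.assoc[symmetric] by (rule sum.atLeastLessThan_concat[symmetric]) auto

lemma weight_root: "leaves L = length a \<Longrightarrow> weight a 0 L = sum_list a"
  by (simp add: weight_def sum_list_sum_nth)

lemma shape_simps [simp]:
  "shape (Leaf k) = Leaf ()" "shape (Node l k r) = Node (shape l) () (shape r)"
  by (simp_all add: shape_def)

lemma leaves_shape: "leaves (shape L) = leaves L"
  by (induction L) auto

lemma same_shape:
  assumes "shape L = shape L'"
  shows "leaves L = leaves L'" "support a p L = support a p L'" "weight a p L = weight a p L'"
proof -
  show "leaves L = leaves L'" using assms by (metis leaves_shape)
  then show "support a p L = support a p L'" "weight a p L = weight a p L'"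
    by (auto simp: support_def weight_def)
qed

lemma vertex_conditions_Node:
  "vertex_conditions a p (Node l k r) \<longleftrightarrow>
     2 * label l \<le> weight a p l \<and> 2 * label r \<le> weight a (p + leaves l) r \<and>
     k + label l \<le> weight a p l + label r \<and> k + label r \<le> weight a (p + leaves l) r + label l \<and>
     label l + label r \<le> k \<and> vertex_conditions a p l \<and> vertex_conditions a (p + leaves l) r"
proof -
  have half: "real i \<le> real N / 2 \<longleftrightarrow> 2 * i \<le> N" for i N :: nat by linarith
  show ?thesis unfolding vertex_conditions.simps Let_def half by linarith
qed

text \<open>The conditions under which a subtree, with its labels, occurs in \<open>\<Phi>\<close> with subset size
\<open>m\<close>. At the root they are those of a representation labeling; at an inner vertex the bound on the
label is the one imposed by the range of summation over \<open>w\<close>.\<close>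

definition admissible :: "nat list \<Rightarrow> nat \<Rightarrow> nat bintree \<Rightarrow> nat \<Rightarrow> bool" where
  "admissible a p L m \<longleftrightarrow> vertex_conditions a p L \<and> label L \<le> m \<and> m + label L \<le> weight a p L"

lemma representation_labeling_iff:
  assumes "leaves T = length a" "m \<le> sum_list a"
  shows "representation_labeling T a m L \<longleftrightarrow> shape L = T \<and> admissible a 0 L m"
proof (cases "shape L = T")
  case True
  then have "leaves L = length a" using assms(1) leaves_shape by metis
  then have "weight a 0 L = sum_list a" by (rule weight_root)
  then show ?thesis
    using True assms(2) by (auto simp: representation_labeling_def admissible_def)
qed (simp add: representation_labeling_def)

section \<open>Inner products of tensors\<close>

definition inner_on :: "nat set \<Rightarrow> nat \<Rightarrow> set_fun \<Rightarrow> set_fun \<Rightarrow> complex" where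
  "inner_on X m f g = (\<Sum>Z\<in>nsets X m. f Z * cnj (g Z))"

text \<open>A subset of a disjoint union is a pair of subsets, here sorted by the number \<open>w\<close> of points in the
second part. This is what turns inner products of tensors into products of inner products.\<close>

lemma sum_nsets_Un:
  assumes "finite X" "finite Y" "X \<inter> Y = {}"
  shows "(\<Sum>Z\<in>nsets (X \<union> Y) m. g (Z \<inter> X) (Z \<inter> Y))
       = (\<Sum>w\<le>m. \<Sum>U\<in>nsets X (m - w). \<Sum>V\<in>nsets Y w. g U V)"
proof -
  have fin: "finite (nsets X k)" "finite (nsets Y k)" for k
    using assms by (auto intro: finite_imp_finite_nsets)
  have "(\<Sum>w\<le>m. \<Sum>U\<in>nsets X (m - w). \<Sum>V\<in>nsets Y w. g U V)
      = (\<Sum>(w, U, V)\<in>(SIGMA w:{..m}. nsets X (m - w) \<times> nsets Y w). g U V)"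
    by (simp add: sum.Sigma sum.cartesian_product fin)
  also have "\<dots> = (\<Sum>Z\<in>nsets (X \<union> Y) m. g (Z \<inter> X) (Z \<inter> Y))"
  proof (rule sum.reindex_bij_witness[where i = "\<lambda>Z. (card (Z \<inter> Y), Z \<inter> X, Z \<inter> Y)" and j = "\<lambda>(w, U, V). U \<union> V"])
    fix t assume "t \<in> (SIGMA w:{..m}. nsets X (m - w) \<times> nsets Y w)"
    then obtain w U V where t: "t = (w, U, V)" "w \<le> m" "U \<in> nsets X (m - w)" "V \<in> nsets Y w" by auto
    have UV: "(U \<union> V) \<inter> X = U" "(U \<union> V) \<inter> Y = V" "U \<inter> V = {}"
      using t assms by (auto simp: nsets_def)
    then show "(card ((case t of (w, U, V) \<Rightarrow> U \<union> V) \<inter> Y), (case t of (w, U, V) \<Rightarrow> U \<union> V) \<inter> X,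
         (case t of (w, U, V) \<Rightarrow> U \<union> V) \<inter> Y) = t"
      using t by (auto simp: nsets_def)
    show "(case t of (w, U, V) \<Rightarrow> U \<union> V) \<in> nsets (X \<union> Y) m"
      using t UV by (auto simp: nsets_def card_Un_disjoint)
    show "g ((case t of (w, U, V) \<Rightarrow> U \<union> V) \<inter> X) ((case t of (w, U, V) \<Rightarrow> U \<union> V) \<inter> Y)
        = (case t of (w, U, V) \<Rightarrow> g U V)"
      using t UV by simp
  next
    fix Z assume Z: "Z \<in> nsets (X \<union> Y) m"
    have ZU: "Z = (Z \<inter> X) \<union> (Z \<inter> Y)" using Z by (auto simp: nsets_def)
    have "card Z = card (Z \<inter> X) + card (Z \<inter> Y)"
      by (subst ZU, subst card_Un_disjoint) (use assms in auto)
    then show "(card (Z \<inter> Y), Z \<inter> X, Z \<inter> Y) \<in> (SIGMA w:{..m}. nsets X (m - w) \<times> nsets Y w)"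
      using Z assms by (auto simp: nsets_def)
    show "(case (card (Z \<inter> Y), Z \<inter> X, Z \<inter> Y) of (w, U, V) \<Rightarrow> U \<union> V) = Z"
      using ZU by simp
  qed
  finally show ?thesis ..
qed

lemma sum_fun_apply: "(\<Sum>i\<in>I. f i) Z = (\<Sum>i\<in>I. f i Z)"
  by (induction I rule: infinite_finite_induct) auto

text \<open>The coefficient in the recursion for \<open>\<Phi>\<close> at a vertex with label \<open>k\<close>, whose sons
have labels \<open>i\<close>, \<open>j\<close> and weights \<open>Nl\<close>, \<open>Nr\<close>.\<close>

definition node_coeff :: "nat \<Rightarrow> nat \<Rightarrow> nat \<Rightarrow> nat \<Rightarrow> nat \<Rightarrow> nat \<Rightarrow> nat \<Rightarrow> complex" where
  "node_coeff k i j Nl Nr m w = of_int (hahn_E (int k - int i - int j) (int Nr - 2 * int j)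
       (int Nl - 2 * int i) (int m - int i - int j) (int w - int j))"

lemma node_coeff_eq_poly:
  assumes "2 * i \<le> Nl" "2 * j \<le> Nr" "k + i \<le> Nl + j" "k + j \<le> Nr + i" "i + j \<le> k" "j \<le> w" "w + i \<le> m"
  shows "node_coeff k i j Nl Nr m w
       = poly (hahn_poly (k - i - j) (Nr - 2 * j) (Nl - 2 * i) (m - i - j)) (of_nat (w - j))"
proof -
  have eqs: "int k - int i - int j = int (k - i - j)" "int Nr - 2 * int j = int (Nr - 2 * j)"
    "int Nl - 2 * int i = int (Nl - 2 * i)" "int m - int i - int j = int (m - i - j)" "int w - int j = int (w - j)"
    using assms by auto
  show ?thesis
    unfolding node_coeff_def eqs by (rule hahn_E_eq_poly) (use assms in auto)
qed

lemma Phi_outside: "Z \<notin> nsets (support a p L) m \<Longrightarrow> \<Phi> a p L m Z = 0"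
proof (cases L)
  case (Node l k r)
  assume Z: "Z \<notin> nsets (support a p L) m"
  show ?thesis
    unfolding Node \<Phi>.simps Let_def sum_fun_apply
  proof (intro sum.neutral ballI)
    fix w assume "w \<in> {max (int (label r)) (int (label l) - int (weight a p l) + int m)..
                 min (int (weight a (p + leaves l) r) - int (label r)) (int m - int (label l))}"
    then have "nat (int m - w) + nat w = m" by auto
    then show "fscale (of_int (hahn_E (int k - int (label l) - int (label r))
                    (int (weight a (p + leaves l) r) - 2 * int (label r))
                    (int (weight a p l) - 2 * int (label l))
                    (int m - int (label l) - int (label r)) (w - int (label r))))
         (tensor (support a p l) (nat (int m - w)) (\<Phi> a p l (nat (int m - w)))
           (support a (p + leaves l) r) (nat w) (\<Phi> a (p + leaves l) r (nat w))) Z = 0"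
      using Z by (simp add: Node support_Node fscale_def tensor_def)
  qed
qed (simp add: sigma_def support_Leaf)

text \<open>At a single subset the sum over \<open>w\<close> has at most one nonzero term, namely the one for \<open>w =
card V\<close>. The condition says that this \<open>w\<close> lies in the range of summation; it is the bound on
the labels of the sons in \<open>admissible\<close>, with subset sizes \<open>card U\<close> and \<open>card
V\<close>.\<close>

lemma Phi_Node_apply:
  assumes "Z \<in> nsets (support a p (Node l k r)) m"
  defines "U \<equiv> Z \<inter> support a p l" and "V \<equiv> Z \<inter> support a (p + leaves l) r"
  shows "\<Phi> a p (Node l k r) m Z =
     (if label l \<le> card U \<and> card U + label l \<le> weight a p l \<and>
         label r \<le> card V \<and> card V + label r \<le> weight a (p + leaves l) r
      then node_coeff k (label l) (label r) (weight a p l) (weight a (p + leaves l) r) m (card V)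
             * (\<Phi> a p l (card U) U * \<Phi> a (p + leaves l) r (card V) V)
      else 0)"
proof -
  define W where "W = {max (int (label r)) (int (label l) - int (weight a p l) + int m)..
                 min (int (weight a (p + leaves l) r) - int (label r)) (int m - int (label l))}"
  define t where "t = node_coeff k (label l) (label r) (weight a p l) (weight a (p + leaves l) r) m (card V)
             * (\<Phi> a p l (card U) U * \<Phi> a (p + leaves l) r (card V) V)"
  have ZU: "Z = U \<union> V" using assms(1) by (auto simp: nsets_def U_def V_def support_Node)
  have "card Z = card U + card V"
    by (subst ZU, subst card_Un_disjoint) (use support_disjoint[of a p l r] in \<open>auto simp: U_def V_def\<close>)
  then have card: "m = card U + card V" using assms(1) by (simp add: nsets_def)
  have "\<Phi> a p (Node l k r) m Z = (\<Sum>w\<in>W. if w = int (card V) then t else 0)"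
    unfolding \<Phi>.simps Let_def sum_fun_apply W_def[symmetric]
  proof (intro sum.cong refl)
    fix w assume w: "w \<in> W"
    then have eq: "nat (int m - w) + nat w = m" by (auto simp: W_def)
    have iff: "card U = nat (int m - w) \<longleftrightarrow> w = int (card V)"
      using w card by (auto simp: W_def)
    show "fscale (of_int (hahn_E (int k - int (label l) - int (label r))
                    (int (weight a (p + leaves l) r) - 2 * int (label r))
                    (int (weight a p l) - 2 * int (label l))
                    (int m - int (label l) - int (label r)) (w - int (label r))))
         (tensor (support a p l) (nat (int m - w)) (\<Phi> a p l (nat (int m - w)))
           (support a (p + leaves l) r) (nat w) (\<Phi> a (p + leaves l) r (nat w))) Z
       = (if w = int (card V) then t else 0)"
    proof (cases "w = int (card V)")
      case True
      then have "nat (int m - w) = card U" using iff by simp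
      then show ?thesis using assms(1) True card
        by (simp add: fscale_def tensor_def t_def node_coeff_def support_Node flip: U_def V_def)
    next
      case False
      then show ?thesis using iff by (simp add: fscale_def tensor_def flip: U_def)
    qed
  qed
  also have "\<dots> = (if int (card V) \<in> W then t else 0)"
    by (simp add: W_def)
  also have "int (card V) \<in> W \<longleftrightarrow> label l \<le> card U \<and> card U + label l \<le> weight a p l \<and>
         label r \<le> card V \<and> card V + label r \<le> weight a (p + leaves l) r"
    using card by (auto simp: W_def)
  finally show ?thesis unfolding t_def .
qed

section \<open>Orthogonality\<close>

text \<open>For admissible labelings, the squared norm of \<open>\<Phi> a p L m\<close> divided by the binomial coefficient
through which it depends on \<open>m\<close>.\<close>

fun gram :: "nat list \<Rightarrow> nat \<Rightarrow> nat bintree \<Rightarrow> complex" where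
  "gram a p (Leaf k) = 1"
| "gram a p (Node l k r) = gram a p l * gram a (p + leaves l) r *
     hahn_norm (k - label l - label r) (weight a (p + leaves l) r - 2 * label r) (weight a p l - 2 * label l)"

lemma gram_nonzero: "vertex_conditions a p L \<Longrightarrow> gram a p L \<noteq> 0"
proof (induction L arbitrary: p)
  case (Node l k r)
  have "hahn_norm (k - label l - label r) (weight a (p + leaves l) r - 2 * label r) (weight a p l - 2 * label l) \<noteq> 0"
    using Node.prems unfolding vertex_conditions_Node by (intro hahn_norm_nonzero) auto
  then show ?case
    using Node.prems Node.IH unfolding vertex_conditions_Node by (simp del: diff_diff_left)
qed auto

text \<open>The induction works because the norms have the form of a constant times \<open>(N - 2 k) choose (m - k)\<close>,
with \<open>N\<close> and \<open>k\<close> the weight and label of the root. If the labelings differ below a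
son, the induction hypothesis kills every term. If both subtrees agree, then the norms of the two sons, as
functions of \<open>w = j + x\<close>, multiply, up to a constant, to the hypergeometric weight in
\<open>x\<close> for which the Hahn polynomials are orthogonal, and the norms of the latter again have the
required form, since \<open>A + B - 2 K = N - 2 k\<close> and \<open>C - K = m - k\<close>.\<close>

lemma inner_Phi:
  assumes "p + leaves L \<le> length a" "shape L = shape L'" "admissible a p L m" "admissible a p L' m"
  shows "inner_on (support a p L) m (\<Phi> a p L m) (\<Phi> a p L' m)
       = (if L = L' then gram a p L * of_nat ((weight a p L - 2 * label L) choose (m - label L)) else 0)"
  using assms
proof (induction L arbitrary: p L' m)
  case (Leaf k)
  then obtain k' where L': "L' = Leaf k'" by (cases L') auto
  have "k = 0" "k' = 0" using Leaf.prems L' by (auto simp: admissible_def)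
  have "inner_on (block a p) m (sigma m (block a p)) (sigma m (block a p)) = of_nat (card (nsets (block a p) m))"
    by (simp add: inner_on_def sigma_def)
  also have "\<dots> = of_nat ((a ! p) choose m)"
    using Leaf.prems(1) n_subsets[of "block a p" m] finite_subset[OF _ finite_block[of a p]]
    by (simp add: nsets_def card_block cong: conj_cong)
  finally show ?case using \<open>k = 0\<close> \<open>k' = 0\<close> L' by (simp add: support_Leaf weight_Leaf)
next
  case (Node l k r)
  then obtain l' k' r' where L': "L' = Node l' k' r'" by (cases L') auto
  define q where "q = p + leaves l"
  define X where "X = support a p l"
  define Y where "Y = support a q r"
  define Nl where "Nl = weight a p l"
  define Nr where "Nr = weight a q r"
  have shapes: "shape l = shape l'" "shape r = shape r'" using Node.prems L' by auto
  have q': "p + leaves l' = q" using same_shape(1)[OF shapes(1)] by (simp add: q_def)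
  have len: "p + leaves l \<le> length a" "q + leaves r \<le> length a"
    using Node.prems by (auto simp: q_def)
  have X': "support a p l' = X" and Y': "support a q r' = Y"
    and Nl': "weight a p l' = Nl" and Nr': "weight a q r' = Nr"
    using same_shape(2,3)[OF shapes(1)] same_shape(2,3)[OF shapes(2)] by (auto simp: X_def Y_def Nl_def Nr_def)
  have XY: "finite X" "finite Y" "X \<inter> Y = {}"
    using support_disjoint[of a p l r] by (auto simp: X_def Y_def q_def)
  have vc: "2 * label l \<le> Nl" "2 * label r \<le> Nr" "k + label l \<le> Nl + label r" "k + label r \<le> Nr + label l"
     "label l + label r \<le> k" "vertex_conditions a p l" "vertex_conditions a q r" "k \<le> m" "m + k \<le> Nl + Nr"
    using Node.prems(3) unfolding admissible_def vertex_conditions_Node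
    by (auto simp: Nl_def Nr_def q_def weight_Node)
  have vc': "2 * label l' \<le> Nl" "2 * label r' \<le> Nr" "k' + label l' \<le> Nl + label r'" "k' + label r' \<le> Nr + label l'"
     "label l' + label r' \<le> k'" "vertex_conditions a p l'" "vertex_conditions a q r'" "k' \<le> m" "m + k' \<le> Nl + Nr"
    using Node.prems(4) unfolding L' admissible_def vertex_conditions_Node
    by (auto simp: Nl' Nr' q' weight_Node)
  define c where "c = (\<lambda>w. label l \<le> m - w \<and> m - w + label l \<le> Nl \<and> label r \<le> w \<and> w + label r \<le> Nr)"
  define c' where "c' = (\<lambda>w. label l' \<le> m - w \<and> m - w + label l' \<le> Nl \<and> label r' \<le> w \<and> w + label r' \<le> Nr)"
  define e where "e = (\<lambda>w. node_coeff k (label l) (label r) Nl Nr m w)"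
  define e' where "e' = (\<lambda>w. node_coeff k' (label l') (label r') Nl Nr m w)"
  have cnj_e': "cnj (e' w) = e' w" for w by (simp add: e'_def node_coeff_def)
  \<comment> \<open>both functions at \<open>Z\<close> depend only on the pair \<open>(Z \<inter> X, Z \<inter> Y)\<close>; \<open>f\<close> and \<open>f'\<close> are these dependences\<close>
  define f where "f = (\<lambda>U V. if c (card V) \<and> card U = m - card V then e (card V) * (\<Phi> a p l (card U) U * \<Phi> a q r (card V) V) else 0)"
  define f' where "f' = (\<lambda>U V. if c' (card V) \<and> card U = m - card V then e' (card V) * (\<Phi> a p l' (card U) U * \<Phi> a q r' (card V) V) else 0)"
  have f: "\<Phi> a p (Node l k r) m Z = f (Z \<inter> X) (Z \<inter> Y)"
    and f': "\<Phi> a p L' m Z = f' (Z \<inter> X) (Z \<inter> Y)" if Z: "Z \<in> nsets (X \<union> Y) m" for Z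
  proof -
    have Z1: "Z \<in> nsets (support a p (Node l k r)) m" and Z2: "Z \<in> nsets (support a p (Node l' k' r')) m"
      using Z by (auto simp: support_Node q' X' Y' simp flip: X_def Y_def q_def)
    have ZU: "Z = (Z \<inter> X) \<union> (Z \<inter> Y)" using Z by (auto simp: nsets_def)
    have "card Z = card (Z \<inter> X) + card (Z \<inter> Y)"
      by (subst ZU, subst card_Un_disjoint) (use XY in auto)
    moreover have "card Z = m" using Z by (simp add: nsets_def)
    ultimately have card: "card (Z \<inter> X) = m - card (Z \<inter> Y)" by arith
    show "\<Phi> a p (Node l k r) m Z = f (Z \<inter> X) (Z \<inter> Y)"
      unfolding Phi_Node_apply[OF Z1]
      by (simp only: f_def c_def e_def card flip: X_def Y_def Nl_def Nr_def q_def) simp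
    show "\<Phi> a p L' m Z = f' (Z \<inter> X) (Z \<inter> Y)"
      unfolding L' Phi_Node_apply[OF Z2]
      by (simp only: f'_def c'_def e'_def card X' Y' Nl' Nr' q') simp
  qed
  have "inner_on (support a p (Node l k r)) m (\<Phi> a p (Node l k r) m) (\<Phi> a p L' m)
      = (\<Sum>Z\<in>nsets (X \<union> Y) m. f (Z \<inter> X) (Z \<inter> Y) * cnj (f' (Z \<inter> X) (Z \<inter> Y)))"
    unfolding inner_on_def support_Node X_def[symmetric] q_def[symmetric] Y_def[symmetric]
    by (intro sum.cong refl) (simp only: f f')
  also have "\<dots> = (\<Sum>w\<le>m. \<Sum>U\<in>nsets X (m - w). \<Sum>V\<in>nsets Y w. f U V * cnj (f' U V))"
    by (rule sum_nsets_Un) (use XY in auto)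
  also have "\<dots> = (\<Sum>w\<le>m. if c w \<and> c' w then e w * e' w *
        (inner_on X (m - w) (\<Phi> a p l (m - w)) (\<Phi> a p l' (m - w)) * inner_on Y w (\<Phi> a q r w) (\<Phi> a q r' w)) else 0)"
  proof (intro sum.cong refl)
    fix w
    have "(\<Sum>U\<in>nsets X (m - w). \<Sum>V\<in>nsets Y w. f U V * cnj (f' U V))
        = (\<Sum>U\<in>nsets X (m - w). \<Sum>V\<in>nsets Y w. if c w \<and> c' w then
             e w * e' w * ((\<Phi> a p l (m - w) U * cnj (\<Phi> a p l' (m - w) U)) * (\<Phi> a q r w V * cnj (\<Phi> a q r' w V))) else 0)"
      by (intro sum.cong refl) (auto simp: f_def f'_def nsets_def cnj_e')
    also have "\<dots> = (if c w \<and> c' w then \<Sum>U\<in>nsets X (m - w). \<Sum>V\<in>nsets Y w.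
             e w * e' w * ((\<Phi> a p l (m - w) U * cnj (\<Phi> a p l' (m - w) U)) * (\<Phi> a q r w V * cnj (\<Phi> a q r' w V))) else 0)"
      by (cases "c w \<and> c' w") (simp_all only: simp_thms if_True if_False sum.neutral_const)
    finally show "(\<Sum>U\<in>nsets X (m - w). \<Sum>V\<in>nsets Y w. f U V * cnj (f' U V))
       = (if c w \<and> c' w then e w * e' w *
        (inner_on X (m - w) (\<Phi> a p l (m - w)) (\<Phi> a p l' (m - w)) * inner_on Y w (\<Phi> a q r w) (\<Phi> a q r' w)) else 0)"
      unfolding inner_on_def sum_product unfolding sum_distrib_left .
  qed
  finally have main: "inner_on (support a p (Node l k r)) m (\<Phi> a p (Node l k r) m) (\<Phi> a p L' m)
      = (\<Sum>w\<le>m. if c w \<and> c' w then e w * e' w *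
        (inner_on X (m - w) (\<Phi> a p l (m - w)) (\<Phi> a p l' (m - w)) * inner_on Y w (\<Phi> a q r w) (\<Phi> a q r' w)) else 0)" .
  have adm: "admissible a p l (m - w)" "admissible a q r w" if "c w" for w
    using that vc(6,7) by (simp_all add: admissible_def c_def Nl_def Nr_def)
  have adm': "admissible a p l' (m - w)" "admissible a q r' w" if "c' w" for w
    using that vc'(6,7) by (simp_all add: admissible_def c'_def Nl' Nr')
  have IHl: "inner_on X (m - w) (\<Phi> a p l (m - w)) (\<Phi> a p l' (m - w))
      = (if l = l' then gram a p l * of_nat ((Nl - 2 * label l) choose (m - w - label l)) else 0)"
    if "c w" "c' w" for w
    unfolding X_def Nl_def
    by (rule Node.IH(1)[OF len(1) shapes(1) adm(1)[OF that(1)] adm'(1)[OF that(2)]])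
  have IHr: "inner_on Y w (\<Phi> a q r w) (\<Phi> a q r' w)
      = (if r = r' then gram a q r * of_nat ((Nr - 2 * label r) choose (w - label r)) else 0)"
    if "c w" "c' w" for w
    unfolding Y_def Nr_def
    by (rule Node.IH(2)[OF len(2) shapes(2) adm(2)[OF that(1)] adm'(2)[OF that(2)]])
  show ?case
  proof (cases "l = l' \<and> r = r'")
    case False
    have "inner_on (support a p (Node l k r)) m (\<Phi> a p (Node l k r) m) (\<Phi> a p L' m) = 0"
      unfolding main using False by (intro sum.neutral) (auto simp: IHl IHr)
    then show ?thesis using False L' by auto
  next
    case True
    then have l': "l' = l" "r' = r" by auto
    define i where "i = label l"
    define j where "j = label r"
    define A where "A = Nr - 2 * j"
    define B where "B = Nl - 2 * i"
    define C where "C = m - i - j"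
    define K where "K = k - i - j"
    define K' where "K' = k' - i - j"
    have cc: "c' w = c w" for w by (simp add: c_def c'_def l')
    let ?s = "\<lambda>w. if c w then e w * e' w * (gram a p l * of_nat (B choose (m - w - i)) * (gram a q r * of_nat (A choose (w - j)))) else 0"
    have "(\<Sum>w\<le>m. if c w \<and> c' w then e w * e' w *
        (inner_on X (m - w) (\<Phi> a p l (m - w)) (\<Phi> a p l' (m - w)) * inner_on Y w (\<Phi> a q r w) (\<Phi> a q r' w)) else 0)
       = (\<Sum>w\<le>m. ?s w)"
    proof (intro sum.cong refl)
      fix w
      show "(if c w \<and> c' w then e w * e' w *
        (inner_on X (m - w) (\<Phi> a p l (m - w)) (\<Phi> a p l' (m - w)) * inner_on Y w (\<Phi> a q r w) (\<Phi> a q r' w)) else 0) = ?s w"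
        using IHl[of w] IHr[of w] by (simp add: cc l' A_def B_def i_def j_def)
    qed
    also have "\<dots> = (\<Sum>w\<in>{j..m - i}. ?s w)"
      by (rule sum.mono_neutral_right) (auto simp: c_def i_def j_def)
    also have "\<dots> = (\<Sum>x\<le>C. ?s (j + x))"
      by (rule sum.reindex_bij_witness[of _ "\<lambda>x. j + x" "\<lambda>w. w - j"])
        (use vc in \<open>auto simp: C_def i_def j_def\<close>)
    also have "\<dots> = (\<Sum>x\<le>C. gram a p l * gram a q r * (of_nat (A choose x) * of_nat (B choose (C - x))
            * (poly (hahn_poly K A B C) (of_nat x) * poly (hahn_poly K' A B C) (of_nat x))))"
    proof (intro sum.cong refl)
      fix x assume x: "x \<in> {..C}"
      have "e (j + x) = poly (hahn_poly K A B C) (of_nat x)" "e' (j + x) = poly (hahn_poly K' A B C) (of_nat x)"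
        unfolding e_def e'_def K_def K'_def A_def B_def C_def l' i_def[symmetric] j_def[symmetric]
        by (subst node_coeff_eq_poly; use vc vc' x in \<open>simp add: i_def j_def C_def l'\<close>)+
      moreover have "m - (j + x) - i = C - x" by (simp add: C_def)
      \<comment> \<open>values of \<open>w\<close> outside the range of summation have weight zero\<close>
      moreover have "of_nat (A choose x) * of_nat (B choose (C - x)) = (0::complex)" if "\<not> c (j + x)"
      proof -
        have "Nl < m - (j + x) + i \<or> Nr < j + x + j"
          using that x vc by (auto simp: c_def C_def i_def j_def)
        then have "B < C - x \<or> A < x"
          using x vc by (auto simp: A_def B_def C_def i_def j_def)
        then show ?thesis by auto
      qed
      ultimately show "?s (j + x) = gram a p l * gram a q r * (of_nat (A choose x) * of_nat (B choose (C - x))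
            * (poly (hahn_poly K A B C) (of_nat x) * poly (hahn_poly K' A B C) (of_nat x)))"
        by (cases "c (j + x)") (auto simp: ac_simps)
    qed
    also have "\<dots> = gram a p l * gram a q r * (if K = K' then hahn_norm K A B * of_nat ((A + B - 2 * K) choose (C - K)) else 0)"
      unfolding sum_distrib_left[symmetric]
      by (subst hahn_poly_orthogonal) (use vc vc' l' in \<open>auto simp: A_def B_def C_def K_def K'_def i_def j_def\<close>)
    also have "K = K' \<longleftrightarrow> Node l k r = L'"
      using vc vc' L' l' by (auto simp: K_def K'_def i_def j_def)
    also have "A + B - 2 * K = weight a p (Node l k r) - 2 * k"
      using vc by (auto simp: A_def B_def K_def i_def j_def weight_Node simp flip: Nl_def Nr_def q_def)
    also have "C - K = m - k" using vc by (auto simp: C_def K_def i_def j_def)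
    finally show ?thesis
      unfolding main
      by (cases "Node l k r = L'") (auto simp: K_def A_def B_def i_def j_def simp flip: Nl_def Nr_def q_def)
  qed
qed

section \<open>Completeness\<close>

lemma fun_vs_subspaceI:
  assumes "0 \<in> S" "\<And>f g. f \<in> S \<Longrightarrow> g \<in> S \<Longrightarrow> f + g \<in> S" "\<And>c f. f \<in> S \<Longrightarrow> fscale c f \<in> S"
  shows "fun_vs.subspace S"
  using assms unfolding fun_vs.subspace_def by blast

lemma tensor_in_span:
  assumes "F \<in> fun_vs.span S" "G \<in> fun_vs.span S'"
    and "\<And>f g. f \<in> S \<Longrightarrow> g \<in> S' \<Longrightarrow> tensor X p f Y q g \<in> fun_vs.span R"
  shows "tensor X p F Y q G \<in> fun_vs.span R"
proof -
  have left: "fun_vs.subspace {F. tensor X p F Y q G \<in> fun_vs.span R}" for G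
  proof (rule fun_vs_subspaceI)
    have "tensor X p 0 Y q G = 0" by (auto simp: tensor_def)
    then show "0 \<in> {F. tensor X p F Y q G \<in> fun_vs.span R}" by (simp add: fun_vs.span_zero)
  next
    fix f g
    have "tensor X p (f + g) Y q G = tensor X p f Y q G + tensor X p g Y q G"
      by (auto simp: tensor_def algebra_simps)
    moreover assume "f \<in> {F. tensor X p F Y q G \<in> fun_vs.span R}" "g \<in> {F. tensor X p F Y q G \<in> fun_vs.span R}"
    ultimately show "f + g \<in> {F. tensor X p F Y q G \<in> fun_vs.span R}" by (simp add: fun_vs.span_add)
  next
    fix c f
    have "tensor X p (fscale c f) Y q G = fscale c (tensor X p f Y q G)"
      by (auto simp: tensor_def fscale_def)
    moreover assume "f \<in> {F. tensor X p F Y q G \<in> fun_vs.span R}"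
    ultimately show "fscale c f \<in> {F. tensor X p F Y q G \<in> fun_vs.span R}" by (simp add: fun_vs.span_scale)
  qed
  have right: "fun_vs.subspace {G. tensor X p F Y q G \<in> fun_vs.span R}" for F
  proof (rule fun_vs_subspaceI)
    have "tensor X p F Y q 0 = 0" by (auto simp: tensor_def)
    then show "0 \<in> {G. tensor X p F Y q G \<in> fun_vs.span R}" by (simp add: fun_vs.span_zero)
  next
    fix f g
    have "tensor X p F Y q (f + g) = tensor X p F Y q f + tensor X p F Y q g"
      by (auto simp: tensor_def algebra_simps)
    moreover assume "f \<in> {G. tensor X p F Y q G \<in> fun_vs.span R}" "g \<in> {G. tensor X p F Y q G \<in> fun_vs.span R}"
    ultimately show "f + g \<in> {G. tensor X p F Y q G \<in> fun_vs.span R}" by (simp add: fun_vs.span_add)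
  next
    fix c f
    have "tensor X p F Y q (fscale c f) = fscale c (tensor X p F Y q f)"
      by (auto simp: tensor_def fscale_def)
    moreover assume "f \<in> {G. tensor X p F Y q G \<in> fun_vs.span R}"
    ultimately show "fscale c f \<in> {G. tensor X p F Y q G \<in> fun_vs.span R}" by (simp add: fun_vs.span_scale)
  qed
  have "tensor X p f Y q G \<in> fun_vs.span R" if "f \<in> S" for f
    using fun_vs.span_minimal[OF _ right, of S' f] that assms(2,3) by blast
  then show ?thesis
    using fun_vs.span_minimal[OF _ left, of S G] assms(1) by blast
qed

text \<open>With the sons and their labelings fixed, the products over the possible sizes \<open>w\<close> and the functions
\<open>\<Phi>\<close> over the possible root labels \<open>k\<close> span the same space: the conditions on
\<open>k\<close> say that \<open>k - i - j\<close> runs from \<open>0\<close> to \<open>D\<close>, and \<open>w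
- j\<close> runs through the interval \<open>I\<close> of \<open>D + 1\<close> integers, so the completeness of
the Hahn polynomials isolates a single \<open>w\<close>.\<close>

lemma tensor_Phi_in_span:
  assumes "admissible a p l u" "admissible a (p + leaves l) r w"
  shows "tensor (support a p l) u (\<Phi> a p l u) (support a (p + leaves l) r) w (\<Phi> a (p + leaves l) r w)
    \<in> fun_vs.span {\<Phi> a p (Node l k r) (u + w) | k. admissible a p (Node l k r) (u + w)}"
    (is "?t \<in> fun_vs.span ?S")
proof -
  define Nl where "Nl = weight a p l"
  define Nr where "Nr = weight a (p + leaves l) r"
  define i where "i = label l"
  define j where "j = label r"
  define A where "A = Nr - 2 * j"
  define B where "B = Nl - 2 * i"
  define C where "C = u + w - i - j"
  define D where "D = min (min A B) (min C (A + B - C))"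
  define I where "I = {C - B..min A C}"
  have adm: "vertex_conditions a p l" "vertex_conditions a (p + leaves l) r"
    "i \<le> u" "u + i \<le> Nl" "j \<le> w" "w + j \<le> Nr"
    using assms by (auto simp: admissible_def i_def j_def Nl_def Nr_def)
  have ABC: "A + 2 * j = Nr" "B + 2 * i = Nl" "C + i + j = u + w" "C \<le> A + B"
    using adm by (auto simp: A_def B_def C_def)
  have D: "D \<le> A" "D \<le> B" "D \<le> C" "C + D \<le> A + B"
    using ABC(4) by (auto simp: D_def)
  have "card I \<le> Suc D" using ABC(4) by (auto simp: I_def D_def min_def)
  moreover have "w - j \<in> I" using adm ABC by (auto simp: I_def)
  moreover have "finite I" by (simp add: I_def)
  ultimately obtain c where c: "\<And>x. x \<in> I \<Longrightarrow>
      (\<Sum>k\<le>D. c k * poly (hahn_poly k A B C) (of_nat x)) = (if x = w - j then 1 else 0)"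
    using hahn_poly_complete[of D A B I "w - j" C] D by blast
  have admissible: "admissible a p (Node l (i + j + k) r) (u + w)" if "k \<le> D" for k
    unfolding admissible_def vertex_conditions_Node weight_Node
    using that D ABC adm by (simp flip: Nl_def Nr_def i_def j_def)
  have "?t = (\<Sum>k\<le>D. fscale (c k) (\<Phi> a p (Node l (i + j + k) r) (u + w)))"
  proof
    fix Z
    show "?t Z = (\<Sum>k\<le>D. fscale (c k) (\<Phi> a p (Node l (i + j + k) r) (u + w))) Z"
    proof (cases "Z \<in> nsets (support a p (Node l 0 r)) (u + w)")
      case False
      then have Z: "Z \<notin> nsets (support a p l \<union> support a (p + leaves l) r) (u + w)"
        by (simp add: support_Node)
      then have "\<Phi> a p (Node l (i + j + k) r) (u + w) Z = 0" for k
        by (intro Phi_outside) (simp add: support_Node)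
      then show ?thesis using Z by (simp add: sum_fun_apply fscale_def tensor_def)
    next
      case True
      define U where "U = Z \<inter> support a p l"
      define V where "V = Z \<inter> support a (p + leaves l) r"
      have Z: "Z \<in> nsets (support a p (Node l k r)) (u + w)" for k
        using True by (simp add: support_Node)
      have ZU: "Z = U \<union> V" using True by (auto simp: nsets_def U_def V_def support_Node)
      have "card Z = card U + card V"
        by (subst ZU, subst card_Un_disjoint) (use support_disjoint[of a p l r] in \<open>auto simp: U_def V_def\<close>)
      then have card: "card U + card V = u + w" using True by (simp add: nsets_def)
      have t: "?t Z = (if card V = w then \<Phi> a p l (card U) U * \<Phi> a (p + leaves l) r (card V) V else 0)"
        using True card by (auto simp: tensor_def support_Node U_def V_def)
      show ?thesis
      proof (cases "i \<le> card U \<and> card U + i \<le> Nl \<and> j \<le> card V \<and> card V + j \<le> Nr")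
        case False
        then have "\<Phi> a p (Node l (i + j + k) r) (u + w) Z = 0" for k
          unfolding Phi_Node_apply[OF Z] by (auto simp: U_def V_def i_def j_def Nl_def Nr_def)
        moreover have "card V \<noteq> w" using False card adm by auto
        ultimately show ?thesis by (simp add: t sum_fun_apply fscale_def)
      next
        case True
        have "\<Phi> a p (Node l (i + j + k) r) (u + w) Z
           = poly (hahn_poly k A B C) (of_nat (card V - j)) * (\<Phi> a p l (card U) U * \<Phi> a (p + leaves l) r (card V) V)"
          if "k \<le> D" for k
        proof -
          have "\<Phi> a p (Node l (i + j + k) r) (u + w) Z = node_coeff (i + j + k) i j Nl Nr (u + w) (card V)
              * (\<Phi> a p l (card U) U * \<Phi> a (p + leaves l) r (card V) V)"
            unfolding Phi_Node_apply[OF Z] using True by (simp add: U_def V_def i_def j_def Nl_def Nr_def)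
          also have "node_coeff (i + j + k) i j Nl Nr (u + w) (card V)
              = poly (hahn_poly (i + j + k - i - j) A B C) (of_nat (card V - j))"
            unfolding A_def B_def C_def
            by (rule node_coeff_eq_poly) (use that True D ABC adm card in linarith)+
          finally show ?thesis by simp
        qed
        then have "(\<Sum>k\<le>D. fscale (c k) (\<Phi> a p (Node l (i + j + k) r) (u + w))) Z
            = (\<Sum>k\<le>D. c k * poly (hahn_poly k A B C) (of_nat (card V - j)))
                * (\<Phi> a p l (card U) U * \<Phi> a (p + leaves l) r (card V) V)"
          by (simp add: sum_fun_apply fscale_def sum_distrib_right mult.assoc)
        also have "(\<Sum>k\<le>D. c k * poly (hahn_poly k A B C) (of_nat (card V - j))) = (if card V - j = w - j then 1 else 0)"
        proof (rule c)
          have "C - B \<le> card V - j" using True card ABC by linarith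
          moreover have "card V - j \<le> A" using True ABC by linarith
          moreover have "card V - j \<le> C" using True card ABC by linarith
          ultimately show "card V - j \<in> I" by (simp add: I_def)
        qed
        also have "card V - j = w - j \<longleftrightarrow> card V = w" using True adm by linarith
        finally show ?thesis by (simp add: t)
      qed
    qed
  qed
  also have "\<dots> \<in> fun_vs.span ?S"
  proof (intro fun_vs.span_sum fun_vs.span_scale fun_vs.span_base)
    fix k assume "k \<in> {..D}"
    then show "\<Phi> a p (Node l (i + j + k) r) (u + w) \<in> ?S" using admissible[of k] by blast
  qed
  finally show ?thesis .
qed

text \<open>The indicator function of the \<open>m\<close>-subsets with \<open>z r\<close> points in block \<open>r\<close>,
for each of the \<open>h\<close> blocks starting with block \<open>p\<close>. Indexing \<open>z\<close> by the
numbers of the blocks lets the same \<open>z\<close> serve for all subtrees.\<close>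

definition profile_ind :: "nat list \<Rightarrow> nat \<Rightarrow> nat \<Rightarrow> nat \<Rightarrow> (nat \<Rightarrow> nat) \<Rightarrow> set_fun" where
  "profile_ind a p h m z = (\<lambda>Z. if Z \<in> nsets (\<Union>r\<in>{p..<p + h}. block a r) m \<and>
      (\<forall>r\<in>{p..<p + h}. card (Z \<inter> block a r) = z r) then 1 else 0)"

lemma card_Int_UN_blocks:
  "finite I \<Longrightarrow> card (Z \<inter> (\<Union>r\<in>I. block a r)) = (\<Sum>r\<in>I. card (Z \<inter> block a r))"
  unfolding Int_UN_distrib
proof (rule card_UN_disjoint)
  show "\<forall>r\<in>I. \<forall>s\<in>I. r \<noteq> s \<longrightarrow> Z \<inter> block a r \<inter> (Z \<inter> block a s) = {}"
    using disjoint_blocks[of _ _ a] by (simp add: disjoint_iff)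
qed auto

text \<open>The number \<open>w\<close> of points in the last \<open>h'\<close> blocks is determined by the profile, so the
indicator is a single tensor product, or zero when \<open>w\<close> exceeds \<open>m\<close>.\<close>

lemma profile_ind_split:
  fixes a :: "nat list" and p h h' m :: nat and z :: "nat \<Rightarrow> nat"
  defines "w \<equiv> \<Sum>r\<in>{p + h..<p + h + h'}. z r"
    and "X \<equiv> \<Union>r\<in>{p..<p + h}. block a r" and "Y \<equiv> \<Union>r\<in>{p + h..<p + h + h'}. block a r"
  shows "profile_ind a p (h + h') m z =
     (if w \<le> m then tensor X (m - w) (profile_ind a p h (m - w) z) Y w (profile_ind a (p + h) h' w z) else 0)"
proof
  fix Z
  have range: "{p..<p + (h + h')} = {p..<p + h} \<union> {p + h..<p + h + h'}" by auto
  have XY: "(\<Union>r\<in>{p..<p + (h + h')}. block a r) = X \<union> Y" unfolding range X_def Y_def by blast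
  have fin: "finite X" "finite Y" by (auto simp: X_def Y_def)
  have "block a s \<inter> block a s' = {}" if "s < p + h" "p + h \<le> s'" for s s'
    using that by (intro disjoint_blocks) simp
  then have disj: "X \<inter> Y = {}" unfolding X_def Y_def by (auto simp: disjoint_iff)
  have blX: "(Z \<inter> X) \<inter> block a r = Z \<inter> block a r" if "r \<in> {p..<p + h}" for r
    using that by (auto simp: X_def)
  have blY: "(Z \<inter> Y) \<inter> block a r = Z \<inter> block a r" if "r \<in> {p + h..<p + h + h'}" for r
    using that by (auto simp: Y_def)
  show "profile_ind a p (h + h') m z Z =
     (if w \<le> m then tensor X (m - w) (profile_ind a p h (m - w) z) Y w (profile_ind a (p + h) h' w z) else 0) Z"
  proof (cases "Z \<in> nsets (X \<union> Y) m")
    case False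
    then show ?thesis unfolding profile_ind_def XY by (auto simp: tensor_def)
  next
    case True
    have ZU: "Z = (Z \<inter> X) \<union> (Z \<inter> Y)" using True by (auto simp: nsets_def)
    have "card Z = card (Z \<inter> X) + card (Z \<inter> Y)"
      by (subst ZU, subst card_Un_disjoint) (use fin disj in auto)
    moreover have "card Z = m" using True by (simp add: nsets_def)
    ultimately have card: "card (Z \<inter> X) + card (Z \<inter> Y) = m" by simp
    show ?thesis
    proof (cases "\<forall>r\<in>{p..<p + (h + h')}. card (Z \<inter> block a r) = z r")
      case prof: True
      have "card (Z \<inter> Y) = w"
        unfolding Y_def w_def by (subst card_Int_UN_blocks) (use prof in auto)
      then have w: "w \<le> m" "card (Z \<inter> X) = m - w" "card (Z \<inter> Y) = w" using card by auto
      have "profile_ind a p h (m - w) z (Z \<inter> X) = 1"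
        unfolding profile_ind_def X_def[symmetric] using w prof blX fin by (auto simp: nsets_def)
      moreover have "profile_ind a (p + h) h' w z (Z \<inter> Y) = 1"
        unfolding profile_ind_def Y_def[symmetric] using w prof blY fin by (auto simp: nsets_def)
      moreover have "profile_ind a p (h + h') m z Z = 1"
        unfolding profile_ind_def XY using True prof by simp
      ultimately show ?thesis using True w by (simp add: tensor_def)
    next
      case prof: False
      then have "profile_ind a p (h + h') m z Z = 0" unfolding profile_ind_def by simp
      moreover have "profile_ind a p h (m - w) z (Z \<inter> X) * profile_ind a (p + h) h' w z (Z \<inter> Y) = 0"
      proof -
        obtain r where r: "r \<in> {p..<p + h} \<or> r \<in> {p + h..<p + h + h'}" "card (Z \<inter> block a r) \<noteq> z r"
          using prof unfolding range by blast
        then show ?thesis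
        proof (elim disjE)
          assume "r \<in> {p..<p + h}"
          then have "profile_ind a p h (m - w) z (Z \<inter> X) = 0"
            unfolding profile_ind_def using r(2) blX by fastforce
          then show ?thesis by simp
        next
          assume "r \<in> {p + h..<p + h + h'}"
          then have "profile_ind a (p + h) h' w z (Z \<inter> Y) = 0"
            unfolding profile_ind_def using r(2) blY by fastforce
          then show ?thesis by simp
        qed
      qed
      ultimately show ?thesis by (simp add: tensor_def)
    qed
  qed
qed

text \<open>Along the tree the indicator of a profile is an iterated tensor product of the functions \<open>\<sigma>\<close>
at the leaves. A product of two spans lies in the span of the products, and these are handled by
\<open>tensor_Phi_in_span\<close>.\<close>

lemma profile_ind_in_span:
  assumes "p + leaves T \<le> length a"
  shows "profile_ind a p (leaves T) m z
     \<in> fun_vs.span {\<Phi> a p L m | L. shape L = T \<and> admissible a p L m}"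
  using assms
proof (induction T arbitrary: p m)
  case (Leaf x)
  let ?S = "{\<Phi> a p L m | L. shape L = Leaf x \<and> admissible a p L m}"
  have block: "(\<Union>r\<in>{p..<p + leaves (Leaf x)}. block a r) = block a p" by simp
  show ?case
  proof (cases "z p = m \<and> m \<le> a ! p")
    case True
    have "profile_ind a p (leaves (Leaf x)) m z = \<Phi> a p (Leaf 0) m"
      unfolding profile_ind_def block using True
      by (auto simp: sigma_def nsets_def fun_eq_iff Int_absorb2)
    moreover have "admissible a p (Leaf 0) m" using True by (simp add: admissible_def weight_Leaf)
    moreover have "shape (Leaf 0 :: nat bintree) = Leaf x" by simp
    ultimately have "profile_ind a p (leaves (Leaf x)) m z \<in> ?S" by blast
    then show ?thesis by (rule fun_vs.span_base)
  next
    case False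
    have "profile_ind a p (leaves (Leaf x)) m z Z = 0" for Z
    proof (rule ccontr)
      assume "profile_ind a p (leaves (Leaf x)) m z Z \<noteq> 0"
      then have Z: "Z \<subseteq> block a p" "card Z = m" "card (Z \<inter> block a p) = z p"
        unfolding profile_ind_def block by (auto simp: nsets_def split: if_splits)
      then have "z p = m" by (simp add: Int_absorb2)
      moreover have "m \<le> a ! p"
        using card_mono[OF finite_block Z(1)] Z(2) card_block[of p a] Leaf by simp
      ultimately show False using False by simp
    qed
    then have "profile_ind a p (leaves (Leaf x)) m z = 0" by (simp add: fun_eq_iff)
    then show ?thesis by (simp only: fun_vs.span_zero)
  qed
next
  case (Node T1 x T2)
  let ?S = "{\<Phi> a p L m | L. shape L = Node T1 x T2 \<and> admissible a p L m}"
  define w where "w = (\<Sum>r\<in>{p + leaves T1..<p + leaves T1 + leaves T2}. z r)"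
  define X where "X = (\<Union>r\<in>{p..<p + leaves T1}. block a r)"
  define Y where "Y = (\<Union>r\<in>{p + leaves T1..<p + leaves T1 + leaves T2}. block a r)"
  have split: "profile_ind a p (leaves (Node T1 x T2)) m z =
     (if w \<le> m then tensor X (m - w) (profile_ind a p (leaves T1) (m - w) z) Y w
          (profile_ind a (p + leaves T1) (leaves T2) w z) else 0)"
    unfolding leaves.simps X_def Y_def w_def by (rule profile_ind_split)
  show ?case
  proof (cases "w \<le> m")
    case False
    then show ?thesis unfolding split if_not_P[OF False] by (intro fun_vs.span_zero)
  next
    case True
    have "tensor X (m - w) (profile_ind a p (leaves T1) (m - w) z) Y w
          (profile_ind a (p + leaves T1) (leaves T2) w z) \<in> fun_vs.span ?S"
    proof (rule tensor_in_span)
      show "profile_ind a p (leaves T1) (m - w) z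
         \<in> fun_vs.span {\<Phi> a p L (m - w) | L. shape L = T1 \<and> admissible a p L (m - w)}"
        using Node.prems by (intro Node.IH) simp
      show "profile_ind a (p + leaves T1) (leaves T2) w z
         \<in> fun_vs.span {\<Phi> a (p + leaves T1) L w | L. shape L = T2 \<and> admissible a (p + leaves T1) L w}"
        using Node.prems by (intro Node.IH) simp
    next
      fix f g
      assume "f \<in> {\<Phi> a p L (m - w) | L. shape L = T1 \<and> admissible a p L (m - w)}"
        "g \<in> {\<Phi> a (p + leaves T1) L w | L. shape L = T2 \<and> admissible a (p + leaves T1) L w}"
      then obtain l r where l: "f = \<Phi> a p l (m - w)" "shape l = T1" "admissible a p l (m - w)"
        and r: "g = \<Phi> a (p + leaves T1) r w" "shape r = T2" "admissible a (p + leaves T1) r w" by blast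
      have lv: "leaves l = leaves T1" "leaves r = leaves T2" using l r leaves_shape by metis+
      have sup: "X = support a p l" "Y = support a (p + leaves l) r"
        by (simp_all add: X_def Y_def support_def lv)
      have "tensor X (m - w) f Y w g
        \<in> fun_vs.span {\<Phi> a p (Node l k r) (m - w + w) | k. admissible a p (Node l k r) (m - w + w)}"
        unfolding sup l(1) r(1) lv(1)[symmetric]
        by (rule tensor_Phi_in_span) (use l r lv in simp_all)
      also have "\<dots> \<subseteq> fun_vs.span ?S"
      proof (rule fun_vs.span_mono, safe)
        fix k assume "admissible a p (Node l k r) (m - w + w)"
        then show "\<exists>L. \<Phi> a p (Node l k r) (m - w + w) = \<Phi> a p L m \<and> shape L = Node T1 x T2 \<and> admissible a p L m"
          using True l r by (intro exI[of _ "Node l k r"]) simp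
      qed
      finally show "tensor X (m - w) f Y w g \<in> fun_vs.span ?S" .
    qed
    then show ?thesis unfolding split using True by simp
  qed
qed

section \<open>Invariant functions\<close>

lemma image_Int_stable: "inj \<pi> \<Longrightarrow> \<pi> ` X = X \<Longrightarrow> \<pi> ` Z \<inter> X = \<pi> ` (Z \<inter> X)"
  using image_Int[of \<pi> Z X] by simp

lemma nsets_image_stable:
  assumes "inj \<pi>" "\<pi> ` X = X"
  shows "\<pi> ` Z \<in> nsets X k \<longleftrightarrow> Z \<in> nsets X k"
proof -
  have "\<pi> ` Z \<subseteq> X \<longleftrightarrow> Z \<subseteq> X" using inj_image_subset_iff[of \<pi> Z X] assms by simp
  moreover have "inj_on \<pi> Z" using assms(1) by (rule inj_on_subset) simp
  ultimately show ?thesis by (simp add: nsets_def finite_image_iff card_image)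
qed

lemma tensor_image:
  assumes "inj \<pi>" "\<pi> ` X = X" "\<pi> ` Y = Y" "\<And>U. F (\<pi> ` U) = F U" "\<And>V. G (\<pi> ` V) = G V"
  shows "tensor X k F Y q G (\<pi> ` Z) = tensor X k F Y q G Z"
proof -
  have "\<pi> ` (X \<union> Y) = X \<union> Y" using assms by (simp add: image_Un)
  moreover have "inj_on \<pi> (Z \<inter> X)" using assms(1) by (rule inj_on_subset) simp
  ultimately show ?thesis
    unfolding tensor_def using assms
    by (simp add: nsets_image_stable image_Int_stable card_image)
qed

lemma Phi_image:
  assumes "inj \<pi>" "\<And>r. r < p + leaves L \<Longrightarrow> \<pi> ` block a r = block a r"
  shows "\<Phi> a p L m (\<pi> ` Z) = \<Phi> a p L m Z"
  using assms(2)
proof (induction L arbitrary: p m Z)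
  case (Leaf k)
  then show ?case using nsets_image_stable[OF assms(1), of "block a p"] by (simp add: sigma_def)
next
  case (Node l k r)
  have sup: "\<pi> ` support a q L = support a q L" if "q + leaves L \<le> p + leaves (Node l k r)" for q and L :: "nat bintree"
    unfolding support_def image_UN using that Node.prems by simp
  have l: "\<Phi> a p l u (\<pi> ` U) = \<Phi> a p l u U" for u U
    by (rule Node.IH(1)) (use Node.prems in simp)
  have r: "\<Phi> a (p + leaves l) r u (\<pi> ` U) = \<Phi> a (p + leaves l) r u U" for u U
    by (rule Node.IH(2)) (use Node.prems in simp)
  have "tensor (support a p l) u (\<Phi> a p l u) (support a (p + leaves l) r) v (\<Phi> a (p + leaves l) r v) (\<pi> ` Z)
     = tensor (support a p l) u (\<Phi> a p l u) (support a (p + leaves l) r) v (\<Phi> a (p + leaves l) r v) Z" for u v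
    by (rule tensor_image) (use assms(1) sup l r in simp_all)
  then show ?case
    unfolding \<Phi>.simps Let_def sum_fun_apply fscale_def by simp
qed

lemma Phi_invariant:
  assumes "leaves L = length a"
  shows "\<Phi> a 0 L m \<in> invariant_functions a m"
proof -
  have "\<Phi> a 0 L m (inv \<pi> ` Z) = \<Phi> a 0 L m Z" if "\<pi> \<in> young_subgroup a" for \<pi> Z
  proof -
    have \<pi>: "\<pi> permutes {1..sum_list a}" "\<And>r. r < length a \<Longrightarrow> \<pi> ` block a r = block a r"
      using that by (auto simp: young_subgroup_def)
    have "\<Phi> a 0 L m (\<pi> ` inv \<pi> ` Z) = \<Phi> a 0 L m (inv \<pi> ` Z)"
      by (rule Phi_image) (use \<pi> assms permutes_inj in auto)
    moreover have "\<pi> ` inv \<pi> ` Z = Z" by (rule image_f_inv_f) (rule permutes_surj[OF \<pi>(1)])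
    ultimately show ?thesis by simp
  qed
  moreover have "\<Phi> a 0 L m \<in> M (sum_list a) m"
    using Phi_outside[of _ a 0 L m] support_root[OF assms] by (auto simp: M_def)
  ultimately show ?thesis by (auto simp: invariant_functions_def perm_act_def)
qed

lemma subspace_invariant_functions: "fun_vs.subspace (invariant_functions a m)"
proof (rule fun_vs_subspaceI)
  have add: "perm_act \<pi> (f + g) = perm_act \<pi> f + perm_act \<pi> g" for \<pi> f g
    by (simp add: perm_act_def fun_eq_iff)
  have scale: "perm_act \<pi> (fscale c f) = fscale c (perm_act \<pi> f)" for \<pi> c f
    by (simp add: perm_act_def fscale_def)
  show "0 \<in> invariant_functions a m"
    by (simp add: invariant_functions_def M_def perm_act_def fun_eq_iff)
  show "f + g \<in> invariant_functions a m"
    if "f \<in> invariant_functions a m" "g \<in> invariant_functions a m" for f g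
    using that unfolding invariant_functions_def by (simp add: M_def add)
  show "fscale c f \<in> invariant_functions a m" if "f \<in> invariant_functions a m" for c f
    using that unfolding invariant_functions_def by (simp add: M_def scale) (simp add: fscale_def)
qed

text \<open>Two subsets with the same profile are joined by transpositions inside blocks: if they differ, then some block
contains a point \<open>x\<close> of the first only and, by equal counts, a point \<open>y\<close> of the second
only, and swapping \<open>x\<close> and \<open>y\<close> brings the first closer to the second.\<close>

lemma invariant_same_profile:
  assumes f: "f \<in> invariant_functions a m"
    and "Z \<in> nsets {1..sum_list a} m" "Z' \<in> nsets {1..sum_list a} m"
    and "\<And>r. r < length a \<Longrightarrow> card (Z \<inter> block a r) = card (Z' \<inter> block a r)"
  shows "f Z = f Z'"
  using assms(2-)
proof (induction "card (Z - Z')" arbitrary: Z rule: less_induct)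
  case less
  have Z: "Z \<subseteq> {1..sum_list a}" "finite Z" "card Z = m" and Z': "Z' \<subseteq> {1..sum_list a}" "finite Z'" "card Z' = m"
    using less.prems by (auto simp: nsets_def)
  show ?case
  proof (cases "Z - Z' = {}")
    case True
    then have "Z = Z'" using Z Z' by (intro card_subset_eq) auto
    then show ?thesis by simp
  next
    case False
    then obtain x where x: "x \<in> Z" "x \<notin> Z'" by blast
    have "{1..sum_list a} = (\<Union>r\<in>{0..<length a}. block a r)"
      using UN_blocks[of a 0 "length a"] by simp
    then obtain r where r: "r < length a" "x \<in> block a r" using x Z by auto
    have "\<not> Z' \<inter> block a r \<subseteq> Z \<inter> block a r"
    proof
      assume "Z' \<inter> block a r \<subseteq> Z \<inter> block a r"
      then have "Z' \<inter> block a r = Z \<inter> block a r"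
        using less.prems(3)[OF r(1)] Z by (intro card_subset_eq) auto
      then show False using x r by blast
    qed
    then obtain y where y: "y \<in> Z'" "y \<in> block a r" "y \<notin> Z" by blast
    define \<pi> where "\<pi> = transpose x y"
    have inj: "inj \<pi>" by (simp add: \<pi>_def)
    have stable: "\<pi> ` block a s = block a s" for s
    proof -
      have "x \<in> block a s \<longleftrightarrow> y \<in> block a s"
        using disjoint_blocks[of r s a] r y by (cases "s = r") auto
      then show ?thesis by (simp add: \<pi>_def transpose_image_eq)
    qed
    have perm: "\<pi> permutes {1..sum_list a}"
      unfolding \<pi>_def using x y Z Z' by (intro permutes_swap_id) auto
    then have "\<pi> \<in> young_subgroup a" using stable by (simp add: young_subgroup_def)
    then have "perm_act \<pi> f Z = f Z" using f by (simp add: invariant_functions_def)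
    then have fZ: "f (\<pi> ` Z) = f Z" by (simp add: perm_act_def \<pi>_def)
    have "f (\<pi> ` Z) = f Z'"
    proof (rule less.hyps)
      have "\<pi> ` Z - Z' \<subseteq> Z - Z' - {x}"
        using x y by (auto simp: \<pi>_def transpose_def split: if_splits)
      moreover have "Z - Z' - {x} \<subset> Z - Z'" using x by blast
      ultimately have "\<pi> ` Z - Z' \<subset> Z - Z'" by blast
      then show "card (\<pi> ` Z - Z') < card (Z - Z')" using Z by (intro psubset_card_mono) auto
      show "\<pi> ` Z \<in> nsets {1..sum_list a} m"
        using nsets_image_stable[OF inj permutes_image[OF perm]] less.prems(1) by simp
      show "card (\<pi> ` Z \<inter> block a s) = card (Z' \<inter> block a s)" if "s < length a" for s
      proof -
        have "\<pi> ` Z \<inter> block a s = \<pi> ` (Z \<inter> block a s)" by (rule image_Int_stable[OF inj stable])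
        moreover have "card (\<pi> ` (Z \<inter> block a s)) = card (Z \<inter> block a s)"
          by (rule card_image) (rule inj_on_subset[OF inj], simp)
        ultimately show ?thesis using less.prems(3)[OF that] by simp
      qed
    qed (rule less.prems(2))
    then show ?thesis using fZ by simp
  qed
qed

lemma invariant_in_span_profile_ind:
  assumes f: "f \<in> invariant_functions a m"
  shows "f \<in> fun_vs.span (range (profile_ind a 0 (length a) m))"
proof -
  let ?N = "nsets {1..sum_list a} m"
  define prof where "prof = (\<lambda>Z r. if r < length a then card (Z \<inter> block a r) else 0)"
  define g where "g = (\<lambda>z. f (SOME Z. Z \<in> ?N \<and> prof Z = z))"
  have sup: "(\<Union>r\<in>{0..<0 + length a}. block a r) = {1..sum_list a}"
    using UN_blocks[of a 0 "length a"] by simp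
  have fin: "finite (prof ` ?N)" by (intro finite_imageI finite_imp_finite_nsets) simp
  have "f = (\<Sum>z\<in>prof ` ?N. fscale (g z) (profile_ind a 0 (length a) m z))"
  proof
    fix Z
    show "f Z = (\<Sum>z\<in>prof ` ?N. fscale (g z) (profile_ind a 0 (length a) m z)) Z"
    proof (cases "Z \<in> ?N")
      case False
      then have "profile_ind a 0 (length a) m z Z = 0" for z unfolding profile_ind_def sup by simp
      moreover have "f Z = 0" using f False by (simp add: invariant_functions_def M_def)
      ultimately show ?thesis by (simp add: sum_fun_apply fscale_def)
    next
      case True
      have "(\<Sum>z\<in>prof ` ?N. fscale (g z) (profile_ind a 0 (length a) m z)) Z
          = (\<Sum>z\<in>prof ` ?N. if z = prof Z then g (prof Z) else 0)"
        unfolding sum_fun_apply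
      proof (intro sum.cong refl)
        fix z assume "z \<in> prof ` ?N"
        then have "(\<forall>r\<in>{0..<0 + length a}. card (Z \<inter> block a r) = z r) \<longleftrightarrow> z = prof Z"
          by (auto simp: prof_def fun_eq_iff)
        then show "fscale (g z) (profile_ind a 0 (length a) m z) Z = (if z = prof Z then g (prof Z) else 0)"
          unfolding fscale_def profile_ind_def sup using True by simp
      qed
      also have "\<dots> = g (prof Z)" using fin True by simp
      also have "g (prof Z) = f Z"
      proof -
        define Z' where "Z' = (SOME Z'. Z' \<in> ?N \<and> prof Z' = prof Z)"
        have "Z' \<in> ?N \<and> prof Z' = prof Z"
          unfolding Z'_def by (rule someI[of _ Z]) (use True in simp)
        then have "f Z' = f Z"
          using True by (intro invariant_same_profile[OF f]) (auto simp: prof_def fun_eq_iff split: if_splits)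
        then show ?thesis by (simp add: g_def Z'_def)
      qed
      finally show ?thesis ..
    qed
  qed
  also have "\<dots> \<in> fun_vs.span (range (profile_ind a 0 (length a) m))"
    by (intro fun_vs.span_sum fun_vs.span_scale fun_vs.span_base) auto
  finally show ?thesis .
qed

lemma orthogonal_independent:
  assumes "pairwise (\<lambda>f g. inner_M n m f g = 0) B" "\<And>f. f \<in> B \<Longrightarrow> inner_M n m f f \<noteq> 0"
  shows "fun_vs.independent B"
proof
  assume "fun_vs.dependent B"
  then obtain f where f: "f \<in> B" "f \<in> fun_vs.span (B - {f})" unfolding fun_vs.dependent_def by blast
  have "fun_vs.subspace {g. inner_M n m g f = 0}"
    by (rule fun_vs_subspaceI)
      (auto simp: inner_M_def fscale_def distrib_right sum.distrib mult.assoc simp flip: sum_distrib_left)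
  moreover have "B - {f} \<subseteq> {g. inner_M n m g f = 0}"
    using assms(1) f(1) by (auto simp: pairwise_def)
  ultimately have "fun_vs.span (B - {f}) \<subseteq> {g. inner_M n m g f = 0}"
    by (intro fun_vs.span_minimal)
  then show False using f assms(2) by blast
qed

theorem corollary3p8:
  fixes a :: "nat list" and n m :: nat and T :: plane_tree
  assumes "composition a n"
    and "length a \<ge> 2"
    and "leaves T = length a"
    and "m \<le> n"
  shows "orthogonal_basis n m
           {\<Phi> a 0 L m | L. representation_labeling T a m L}
           (invariant_functions a m)"
proof -
  have n: "n = sum_list a" using assms(1) by (simp add: composition_def)
  define B where "B = {\<Phi> a 0 L m | L. shape L = T \<and> admissible a 0 L m}"
  have B: "{\<Phi> a 0 L m | L. representation_labeling T a m L} = B"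
    unfolding B_def using representation_labeling_iff[OF assms(3)] assms(4) n by simp
  have leaves: "leaves L = length a" if "shape L = T" for L :: "nat bintree"
    using that assms(3) leaves_shape by metis
  have inner: "inner_M n m (\<Phi> a 0 L m) (\<Phi> a 0 L' m)
      = (if L = L' then gram a 0 L * of_nat ((n - 2 * label L) choose (m - label L)) else 0)"
    if "shape L = T" "admissible a 0 L m" "shape L' = T" "admissible a 0 L' m" for L L'
  proof -
    have L: "leaves L = length a" "support a 0 L = {1..n}" "weight a 0 L = n"
      using leaves[OF that(1)] support_root weight_root n by auto
    have "inner_M n m (\<Phi> a 0 L m) (\<Phi> a 0 L' m) = inner_on (support a 0 L) m (\<Phi> a 0 L m) (\<Phi> a 0 L' m)"
      unfolding L inner_on_def inner_M_def ..
    also have "\<dots> = (if L = L' then gram a 0 L * of_nat ((weight a 0 L - 2 * label L) choose (m - label L)) else 0)"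
      by (rule inner_Phi) (use L that in simp_all)
    finally show ?thesis unfolding L .
  qed
  have pw: "pairwise (\<lambda>f g. inner_M n m f g = 0) B"
    unfolding pairwise_def B_def using inner by fastforce
  have "inner_M n m f f \<noteq> 0" if f: "f \<in> B" for f
  proof -
    obtain L where L: "f = \<Phi> a 0 L m" "shape L = T" "admissible a 0 L m"
      using f by (auto simp: B_def)
    have "m - label L \<le> n - 2 * label L" "vertex_conditions a 0 L"
      using L(3) weight_root[OF leaves[OF L(2)]] n by (auto simp: admissible_def)
    then show ?thesis
      using inner[OF L(2,3) L(2,3)] gram_nonzero L(1) by (simp add: not_less)
  qed
  then have "fun_vs.independent B" by (rule orthogonal_independent[OF pw])
  moreover have "fun_vs.span B = invariant_functions a m"
  proof
    show "fun_vs.span B \<subseteq> invariant_functions a m"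
      by (rule fun_vs.span_minimal[OF _ subspace_invariant_functions])
        (use Phi_invariant leaves in \<open>auto simp: B_def\<close>)
    have "range (profile_ind a 0 (length a) m) \<subseteq> fun_vs.span B"
      using profile_ind_in_span[of 0 T a m] assms(3) by (auto simp: B_def)
    then have "fun_vs.span (range (profile_ind a 0 (length a) m)) \<subseteq> fun_vs.span B"
      by (rule fun_vs.span_minimal) (rule fun_vs.subspace_span)
    then show "invariant_functions a m \<subseteq> fun_vs.span B"
      using invariant_in_span_profile_ind by blast
  qed
  ultimately show ?thesis
    unfolding orthogonal_basis_def B using pw by simp
qed

end
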